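(* Fix $0<k<1$, and let $a_1=\frac{1-\sqrt{1-k^2}}{k}$, $a_2=\frac{1+\sqrt{1-k^2}}{k}$, $b_1=k$ and $b_2=\frac1k$ (so that $a_1<b_1<b_2<a_2$). For $a\in\mathbb R$ consider the system $$u_{tt}-u_{xx}=0 \text{ in } Q^k,\qquad u_x(0,t)=0,\quad u_x(l_k(t),t)+a\,u_t(l_k(t),t)=0 \ \text{ for } t\in(0,\infty),\qquad u(x,0)=u^0,\ u_t(x,0)=u^1 \text{ in }(0,1),$$ with energy $E_1(t)=\frac12\int_0^{l_k(t)}\big[u_t^2(x,t)+u_x^2(x,t)\big]dx$. Then: (1) If $a<a_1$ or $a>a_2$, then the energy of the system is increasing. Furthermore, there exist solutions of the system such that the corresponding energy increases only at a polynomial rate. (2) If $a=a_1$ or $a=a_2$, then the energy of the system is conserved. (3) If $a_1<a<a_2$, then the energy of the system is decreasing. Moreover, there exist solutions of the system such that the corresponding energy decreases only at a polynomial rate. For $a=b_1$ or $a=b_2$, the energy of the system decays only at a rate of first order polynomials; for $b_1<a<b_2$, the energy of the system decays at a rate which is no less than first order polynomials; for $a_1<a<b_1$ or $b_2<a<a_2$, the energy of the system decays at a rate which is no more than first order polynomials.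
   Context: For $0<k<1$, $l_k(t)=1+kt$ and $Q^k=\{(x,t)\in\mathbb R^2 : 0<x<l_k(t),\ t>0\}$. The initial data satisfy $(u^0,u^1)\in H^1(0,1)\times L^2(0,1)$, and $u\in H^1_{loc}(Q^k)$ is a weak solution, where $H^1_{loc}(Q^k)$ is the space of distributions $\phi$ on $Q^k$ such that $\psi\phi\in H^1(Q^k)$ for all $\psi\in C_0^\infty(\mathbb R^2)$. Weak solution means: the wave equation holds in the sense of distributions in $Q^k$, and (since then $u(x,t)=f(t+x)+g(t-x)$ with $f,g\in H^1_{loc}(\mathbb R)$) the boundary and initial conditions hold almost everywhere when $u_x,u_t$ are computed from this representation. "Increasing" and "decreasing" are understood in the non-strict sense: $E_1(t)\ge E_1(s)$, respectively $E_1(t)\le E_1(s)$, for $t\ge s\ge0$. "Conserved" means $E_1(t)=E_1(0)$ for all $t\ge 0$. Rates of decay (the constants and the polynomial do not depend on the initial data): - The energy decays only at a rate of $m$-th order polynomials if there exist constants $c_1,c_2>0$ and an $m$-th order polynomial $\varphi(t)$ such that $c_1[\varphi(t)]^{-1}E_1(0)\le E_1(t)\le c_2E_1(0)[\varphi(t)]^{-1}$ for $t>0$. - The energy decays at a rate which is no less than $m$-th order polynomials if there exist a constant $C>0$ and an $m$-th order polynomial $\varphi(t)$ such that $E_1(t)\le CE_1(0)[\varphi(t)]^{-1}$ for $t>0$. - The energy decays at a rate which is no more than $m$-th order polynomials if there exist a constant $C>0$ and an $m$-th order polynomial $\varphi(t)$ such that $E_1(t)\ge CE_1(0)[\varphi(t)]^{-1}$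 for $t>0$. The energy of a particular solution increases (respectively decreases) only at a polynomial rate if there are constants $c_1,c_2>0$ and a real exponent $p>0$ (respectively $p<0$) such that $c_1(1+t)^pE_1(0)\le E_1(t)\le c_2(1+t)^pE_1(0)$ for all $t>0$. *)

theory Defs
  imports "HOL-Analysis.Analysis" "HOL-Computational_Algebra.Polynomial"
begin

section \<open>Test functions, weak derivatives and Sobolev spaces\<close>

text \<open>For a smooth function this is the classical partial derivative in direction \<open>v\<close>.\<close>

definition dir_deriv :: "'a::euclidean_space \<Rightarrow> ('a \<Rightarrow> real) \<Rightarrow> 'a \<Rightarrow> real" where
  "dir_deriv v \<eta> = (\<lambda>z. frechet_derivative \<eta> (at z) v)"

primrec Ck :: "nat \<Rightarrow> ('a::euclidean_space \<Rightarrow> real) \<Rightarrow> bool" where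
  "Ck 0 \<eta> \<longleftrightarrow> continuous_on UNIV \<eta>"
| "Ck (Suc n) \<eta> \<longleftrightarrow> (\<forall>z. \<eta> differentiable (at z)) \<and> (\<forall>v. Ck n (dir_deriv v \<eta>))"

definition test_function :: "'a::euclidean_space set \<Rightarrow> ('a \<Rightarrow> real) \<Rightarrow> bool" where
  "test_function \<Omega> \<eta> \<longleftrightarrow> (\<forall>n. Ck n \<eta>) \<and>
     compact (closure {z. \<eta> z \<noteq> 0}) \<and> closure {z. \<eta> z \<noteq> 0} \<subseteq> \<Omega>"

definition L2 :: "'a::euclidean_space set \<Rightarrow> ('a \<Rightarrow> real) \<Rightarrow> bool" where
  "L2 S v \<longleftrightarrow> set_borel_measurable lebesgue S v \<and> set_integrable lebesgue S (\<lambda>z. (v z)\<^sup>2)"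

text \<open>Distributions belonging to \<open>H\<^sup>1\<close> or to \<open>H\<^sup>1\<^sub>l\<^sub>o\<^sub>c\<close> are functions, so they are represented by
  functions. \<open>weak_deriv \<Omega> b v w\<close>: the distributional derivative of \<open>v\<close> in direction \<open>b\<close> on the
  open set \<open>\<Omega>\<close> is \<open>w\<close>, where both are square integrable on compact subsets of \<open>\<Omega>\<close>; this is the
  only case that occurs, and it makes the integrals below proper.\<close>

definition weak_deriv ::
    "'a::euclidean_space set \<Rightarrow> 'a \<Rightarrow> ('a \<Rightarrow> real) \<Rightarrow> ('a \<Rightarrow> real) \<Rightarrow> bool" where
  "weak_deriv \<Omega> b v w \<longleftrightarrow>
     (\<forall>K. compact K \<and> K \<subseteq> \<Omega> \<longrightarrow> L2 K v \<and> L2 K w) \<and>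
     (\<forall>\<eta>. test_function \<Omega> \<eta> \<longrightarrow>
        (LINT z:\<Omega>|lebesgue. v z * dir_deriv b \<eta> z) = - (LINT z:\<Omega>|lebesgue. w z * \<eta> z))"

definition H1 :: "'a::euclidean_space set \<Rightarrow> ('a \<Rightarrow> real) \<Rightarrow> bool" where
  "H1 \<Omega> v \<longleftrightarrow> L2 \<Omega> v \<and> (\<forall>b\<in>Basis. \<exists>w. L2 \<Omega> w \<and> weak_deriv \<Omega> b v w)"

text \<open>The cut-off functions live on the whole space, so they need not vanish on the boundary of
  \<open>\<Omega>\<close>: this space is local at infinity only.\<close>

definition H1_loc :: "'a::euclidean_space set \<Rightarrow> ('a \<Rightarrow> real) \<Rightarrow> bool" where
  "H1_loc \<Omega> v \<longleftrightarrow> (\<forall>\<psi>. test_function UNIV \<psi> \<longrightarrow> H1 \<Omega> (\<lambda>z. \<psi> z * v z))"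

section \<open>The wave equation in the expanding interval\<close>

definition len :: "real \<Rightarrow> real \<Rightarrow> real" where
  "len k t = 1 + k * t"

definition Q :: "real \<Rightarrow> (real \<times> real) set" where
  "Q k = {(x, t). 0 < x \<and> x < len k t \<and> t > 0}"

definition wave_equation :: "(real \<times> real) set \<Rightarrow> (real \<times> real \<Rightarrow> real) \<Rightarrow> bool" where
  "wave_equation \<Omega> u \<longleftrightarrow> (\<forall>\<eta>. test_function \<Omega> \<eta> \<longrightarrow>
     (LINT z:\<Omega>|lebesgue.
        u z * (dir_deriv (0, 1) (dir_deriv (0, 1) \<eta>) z
             - dir_deriv (1, 0) (dir_deriv (1, 0) \<eta>) z)) = 0)"

text \<open>The values of \<open>u\<^sub>x\<close> and \<open>u\<^sub>t\<close> on a line \<open>t = const\<close> or on the boundary are those computed from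
  the representation \<open>u(x,t) = f(t + x) + g(t - x)\<close>. The functions \<open>ux\<close> and \<open>ut\<close> so obtained are
  therefore arguments of the predicate, next to \<open>u\<close>. Up to null sets \<open>f'\<close> on \<open>(0,\<infinity>)\<close> and \<open>g'\<close> on
  \<open>(-1,\<infinity>)\<close> are determined by \<open>u\<close>, and only these enter below, so neither the boundary conditions
  nor the energy depends on the choice of the representation.\<close>

definition weak_solution ::
    "real \<Rightarrow> real \<Rightarrow> (real \<Rightarrow> real) \<Rightarrow> (real \<Rightarrow> real) \<Rightarrow>
     (real \<times> real \<Rightarrow> real) \<Rightarrow> (real \<times> real \<Rightarrow> real) \<Rightarrow> (real \<times> real \<Rightarrow> real) \<Rightarrow> bool" where
  "weak_solution k a u0 u1 u ux ut \<longleftrightarrow>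
     H1 {0<..<1} u0 \<and> L2 {0<..<1} u1 \<and>
     H1_loc (Q k) u \<and> wave_equation (Q k) u \<and>
     (\<exists>f g f' g'.
        H1_loc UNIV f \<and> weak_deriv UNIV 1 f f' \<and>
        H1_loc UNIV g \<and> weak_deriv UNIV 1 g g' \<and>
        (AE z in lebesgue. z \<in> Q k \<longrightarrow> u z = f (snd z + fst z) + g (snd z - fst z)) \<and>
        ux = (\<lambda>(x, t). f' (t + x) - g' (t - x)) \<and>
        ut = (\<lambda>(x, t). f' (t + x) + g' (t - x)) \<and>
        (AE t in lebesgue. t > 0 \<longrightarrow> ux (0, t) = 0) \<and>
        (AE t in lebesgue. t > 0 \<longrightarrow> ux (len k t, t) + a * ut (len k t, t) = 0) \<and>
        (AE x in lebesgue. x \<in> {0<..<1} \<longrightarrow> f x + g (- x) = u0 x) \<and>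
        (AE x in lebesgue. x \<in> {0<..<1} \<longrightarrow> ut (x, 0) = u1 x))"

definition energy ::
    "real \<Rightarrow> (real \<times> real \<Rightarrow> real) \<Rightarrow> (real \<times> real \<Rightarrow> real) \<Rightarrow> real \<Rightarrow> real" where
  "energy k ux ut t =
     1 / 2 * (LINT x:{0..len k t}|lebesgue. (ut (x, t))\<^sup>2 + (ux (x, t))\<^sup>2)"

section \<open>Behaviour of the energy\<close>

definition energy_increasing :: "real \<Rightarrow> real \<Rightarrow> bool" where
  "energy_increasing k a \<longleftrightarrow> (\<forall>u0 u1 u ux ut. weak_solution k a u0 u1 u ux ut \<longrightarrow>
     (\<forall>s t. 0 \<le> s \<and> s \<le> t \<longrightarrow> energy k ux ut t \<ge> energy k ux ut s))"

definition energy_decreasing :: "real \<Rightarrow> real \<Rightarrow> bool" where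
  "energy_decreasing k a \<longleftrightarrow> (\<forall>u0 u1 u ux ut. weak_solution k a u0 u1 u ux ut \<longrightarrow>
     (\<forall>s t. 0 \<le> s \<and> s \<le> t \<longrightarrow> energy k ux ut t \<le> energy k ux ut s))"

definition energy_conserved :: "real \<Rightarrow> real \<Rightarrow> bool" where
  "energy_conserved k a \<longleftrightarrow> (\<forall>u0 u1 u ux ut. weak_solution k a u0 u1 u ux ut \<longrightarrow>
     (\<forall>t\<ge>0. energy k ux ut t = energy k ux ut 0))"

text \<open>The next two predicates are about one energy function \<open>E\<close>.\<close>

definition increases_only_polynomially :: "(real \<Rightarrow> real) \<Rightarrow> bool" where
  "increases_only_polynomially E \<longleftrightarrow> (\<exists>c1>0. \<exists>c2>0. \<exists>p>0. \<forall>t>0.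
     c1 * (1 + t) powr p * E 0 \<le> E t \<and> E t \<le> c2 * (1 + t) powr p * E 0)"

definition decreases_only_polynomially :: "(real \<Rightarrow> real) \<Rightarrow> bool" where
  "decreases_only_polynomially E \<longleftrightarrow> (\<exists>c1>0. \<exists>c2>0. \<exists>p<0. \<forall>t>0.
     c1 * (1 + t) powr p * E 0 \<le> E t \<and> E t \<le> c2 * (1 + t) powr p * E 0)"

text \<open>The comparison polynomials are required to be positive for \<open>t > 0\<close>. Otherwise a lower bound
  with, say, \<open>\<phi>(t) = - 1 - t\<close> would hold for every nonnegative energy.\<close>

definition rate_polynomial :: "nat \<Rightarrow> real poly \<Rightarrow> bool" where
  "rate_polynomial m \<phi> \<longleftrightarrow> degree \<phi> = m \<and> (\<forall>t>0. poly \<phi> t > 0)"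

definition decays_only_at_order :: "nat \<Rightarrow> real \<Rightarrow> real \<Rightarrow> bool" where
  "decays_only_at_order m k a \<longleftrightarrow> (\<exists>c1>0. \<exists>c2>0. \<exists>\<phi>. rate_polynomial m \<phi> \<and>
     (\<forall>u0 u1 u ux ut. weak_solution k a u0 u1 u ux ut \<longrightarrow> (\<forall>t>0.
        c1 * inverse (poly \<phi> t) * energy k ux ut 0 \<le> energy k ux ut t \<and>
        energy k ux ut t \<le> c2 * energy k ux ut 0 * inverse (poly \<phi> t))))"

definition decays_no_less_than_order :: "nat \<Rightarrow> real \<Rightarrow> real \<Rightarrow> bool" where
  "decays_no_less_than_order m k a \<longleftrightarrow> (\<exists>C>0. \<exists>\<phi>. rate_polynomial m \<phi> \<and>
     (\<forall>u0 u1 u ux ut. weak_solution k a u0 u1 u ux ut \<longrightarrow> (\<forall>t>0.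
        energy k ux ut t \<le> C * energy k ux ut 0 * inverse (poly \<phi> t))))"

definition decays_no_more_than_order :: "nat \<Rightarrow> real \<Rightarrow> real \<Rightarrow> bool" where
  "decays_no_more_than_order m k a \<longleftrightarrow> (\<exists>C>0. \<exists>\<phi>. rate_polynomial m \<phi> \<and>
     (\<forall>u0 u1 u ux ut. weak_solution k a u0 u1 u ux ut \<longrightarrow> (\<forall>t>0.
        energy k ux ut t \<ge> C * energy k ux ut 0 * inverse (poly \<phi> t))))"

text \<open>Two degenerate parameters. For \<open>a = -1\<close> the condition at the moving end reads \<open>g' = 0\<close> on
  \<open>(-1,\<infinity>)\<close>, so every solution has energy \<open>0\<close>. For \<open>a = 1\<close> it reads \<open>f' = 0\<close> on \<open>(1,\<infinity>)\<close>, so the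
  energy of every solution vanishes after finite time, and no solution with \<open>E(0) > 0\<close> decays only
  at a polynomial rate. For these values only a solution with \<open>E(0) = 0\<close> has a polynomial rate.\<close>

end

theory Submission
  imports Defs
begin

text \<open>
  Write \<open>u(x,t) = f(t + x) + g(t - x)\<close> and \<open>h = g'\<close>. The condition at \<open>x = 0\<close> says \<open>f' = h\<close> on
  \<open>(0,\<infinity>)\<close>, so the energy at time \<open>t\<close> is the integral of \<open>h\<^sup>2\<close> over \<open>[(1 - k)t - 1, (1 + k)t + 1]\<close>, and
  the condition at the moving end says \<open>(1 + a) h((1 + k)t + 1) = (1 - a) h((1 - k)t - 1)\<close>. After the
  shift \<open>T = t + 1/k\<close> both end points are multiples of \<open>T\<close>. Hence the energy with the extra
  weight \<open>(z + 1/k)\<^sup>j\<close> is monotone in \<open>t\<close>, with the sign of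
  \<open>(1 + k)\<^bsup>j+1\<^esup> (1 - a)\<^sup>2 - (1 - k)\<^bsup>j+1\<^esup> (1 + a)\<^sup>2\<close>, and it is comparable with \<open>T\<^sup>j\<close> times the energy.
  The weight \<open>j = 0\<close> gives monotonicity of the energy, \<open>j = 1\<close> the first order rates, and for
  \<open>a \<noteq> \<plusminus>1\<close> the exponent \<open>j\<close> for which the weighted energy is conserved shows that every solution
  behaves like \<open>T\<^bsup>-j\<^esup>\<close>.
\<close>

section \<open>Weak derivatives of continuously differentiable functions\<close>

lemma continuous_compact_support_integrable:
  fixes \<phi> :: "'a::euclidean_space \<Rightarrow> real"
  assumes "continuous_on UNIV \<phi>" "compact K" "\<And>z. z \<notin> K \<Longrightarrow> \<phi> z = 0"
  shows "integrable lborel \<phi>"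
proof -
  have "integrable lborel (\<lambda>x. indicator K x *\<^sub>R \<phi> x)"
    by (rule borel_integrable_compact[OF assms(2)]) (use assms continuous_on_subset in blast)
  also have "(\<lambda>x. indicator K x *\<^sub>R \<phi> x) = \<phi>"
    using assms(3) by (auto simp: indicator_def fun_eq_iff)
  finally show ?thesis .
qed

text \<open>Difference quotients along \<open>b\<close> integrate to 0 because Lebesgue measure is
  translation invariant, and dominated convergence carries this over to the derivative.
  Differentiability is asked for along \<open>b\<close> alone, so \<open>\<phi>\<close> may be rough
  in the other directions.\<close>

lemma integral_directional_derivative_eq_0:
  fixes \<phi> :: "'a::euclidean_space \<Rightarrow> real"
  assumes der: "\<And>z. ((\<lambda>s. \<phi> (z + s *\<^sub>R b)) has_real_derivative \<phi>' z) (at 0)"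
    and cont: "continuous_on UNIV \<phi>" "continuous_on UNIV \<phi>'"
    and K: "compact K" and supp: "\<And>z. z \<notin> K \<Longrightarrow> \<phi> z = 0"
  shows "(LINT z|lborel. \<phi>' z) = 0"
proof -
  define s where "s n = 1 / real (Suc n)" for n
  define d where "d n z = (\<phi> (z + s n *\<^sub>R b) - \<phi> z) / s n" for n z
  \<comment> \<open>\<open>K1\<close> collects the points from which a step
    \<open>r *\<^sub>R b\<close> with \<open>r\<close> in \<open>{0..1}\<close> can land in
    \<open>K\<close>, so every \<open>d n\<close> vanishes off it. \<open>K2\<close> collects the
    points reached from \<open>K1\<close> by such steps, which is where the mean value theorem
    evaluates \<open>\<phi>'\<close>. Compactness of both yields one integrable majorant for all
    \<open>n\<close>.\<close>
  define K1 where "K1 = (\<lambda>(x, r). x - r *\<^sub>R b) ` (K \<times> {0..1})"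
  define K2 where "K2 = (\<lambda>(x, r). x + r *\<^sub>R b) ` (K1 \<times> {0..1})"
  have s: "0 < s n" "s n \<le> 1" for n
    by (auto simp: s_def)
  have meas: "\<phi> \<in> borel_measurable borel" "\<phi>' \<in> borel_measurable borel"
    using cont by (auto intro: borel_measurable_continuous_onI)
  have K1: "compact K1"
    unfolding K1_def case_prod_unfold
    by (intro compact_continuous_image continuous_intros compact_Times K compact_Icc)
  have K2: "compact K2"
    unfolding K2_def case_prod_unfold
    by (intro compact_continuous_image continuous_intros compact_Times K1 compact_Icc)
  obtain B where B: "\<And>z. z \<in> K2 \<Longrightarrow> \<bar>\<phi>' z\<bar> \<le> B"
    using compact_continuous_image[OF continuous_on_subset[OF cont(2)] K2]
    by (force dest!: compact_imp_bounded simp: bounded_iff)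
  have int_phi: "integrable lborel \<phi>"
    using cont(1) K supp by (rule continuous_compact_support_integrable)
  have transl: "integrable lborel (\<lambda>z. \<phi> (z + c))" "(LINT z|lborel. \<phi> (z + c)) = (LINT z|lborel. \<phi> z)" for c
  proof -
    have D: "lborel = distr lborel borel ((+) c)" by (simp add: lborel_distr_plus)
    have "integrable (distr lborel borel ((+) c)) \<phi>" using int_phi D by simp
    then show "integrable lborel (\<lambda>z. \<phi> (z + c))"
      by (subst (asm) integrable_distr_eq) (use meas in \<open>auto simp: add.commute\<close>)
    have "(LINT z|lborel. \<phi> z) = (LINT z|distr lborel borel ((+) c). \<phi> z)" using D by simp
    also have "\<dots> = (LINT z|lborel. \<phi> (z + c))"
      by (subst integral_distr) (use meas in \<open>auto simp: add.commute\<close>)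
    finally show "(LINT z|lborel. \<phi> (z + c)) = (LINT z|lborel. \<phi> z)" by simp
  qed
  have d0: "(LINT z|lborel. d n z) = 0" for n
    unfolding d_def using transl int_phi by simp
  have der': "((\<lambda>r. \<phi> (z + r *\<^sub>R b)) has_real_derivative \<phi>' (z + r *\<^sub>R b)) (at r)" for z r
    using der[of "z + r *\<^sub>R b"] DERIV_shift[of "\<lambda>r. \<phi> (z + r *\<^sub>R b)" "\<phi>' (z + r *\<^sub>R b)" 0 r]
    by (simp add: algebra_simps)
  have bound: "\<bar>d n z\<bar> \<le> \<bar>B\<bar> * indicator K1 z" for n z
  proof (cases "z \<in> K1")
    case False
    have "\<phi> (z + r *\<^sub>R b) = 0" if "0 \<le> r" "r \<le> 1" for r
    proof (rule supp, rule notI)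
      assume "z + r *\<^sub>R b \<in> K"
      then have "z \<in> K1" using that unfolding K1_def
        by (intro image_eqI[of _ _ "(z + r *\<^sub>R b, r)"]) auto
      with False show False by simp
    qed
    from this[of "s n"] this[of 0] s[of n] show ?thesis by (simp add: d_def)
  next
    case True
    obtain r where r: "0 < r" "r < s n"
      "\<phi> (z + s n *\<^sub>R b) - \<phi> (z + 0 *\<^sub>R b) = (s n - 0) * \<phi>' (z + r *\<^sub>R b)"
      using MVT2[OF s(1)[of n], of "\<lambda>r. \<phi> (z + r *\<^sub>R b)" "\<lambda>r. \<phi>' (z + r *\<^sub>R b)"] der' by blast
    have "z + r *\<^sub>R b \<in> K2" using True r s(2)[of n] unfolding K2_def
      by (intro image_eqI[of _ _ "(z, r)"]) auto
    then have "\<bar>\<phi>' (z + r *\<^sub>R b)\<bar> \<le> B" by (rule B)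
    moreover have "d n z = \<phi>' (z + r *\<^sub>R b)" using r s(1)[of n] by (simp add: d_def)
    ultimately show ?thesis using True by simp
  qed
  have lim: "(\<lambda>n. d n z) \<longlonglongrightarrow> \<phi>' z" for z
  proof -
    have "filterlim s (at 0) sequentially"
      unfolding filterlim_at using s LIMSEQ_Suc[OF lim_1_over_n[where 'a=real]]
      by (simp add: s_def[abs_def] del: of_nat_Suc)
    then show ?thesis using der[of z] unfolding DERIV_def d_def
      by (auto dest: filterlim_compose)
  qed
  have "(\<lambda>n. LINT z|lborel. d n z) \<longlonglongrightarrow> (LINT z|lborel. \<phi>' z)"
  proof (rule integral_dominated_convergence[where w="\<lambda>z. \<bar>B\<bar> * indicator K1 z"])
    show "integrable lborel (\<lambda>z. \<bar>B\<bar> * indicator K1 z :: real)"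
      using K1 by (intro integrable_mult_right integrable_real_indicator)
        (auto simp: emeasure_compact_finite[unfolded infinity_ennreal_def] borel_compact)
    show "AE z in lborel. (\<lambda>n. d n z) \<longlonglongrightarrow> \<phi>' z" using lim by simp
    show "AE z in lborel. norm (d n z) \<le> \<bar>B\<bar> * indicator K1 z" for n using bound by simp
    show "d n \<in> borel_measurable lborel" for n using meas unfolding d_def by measurable
  qed (use meas in simp)
  then show ?thesis using d0 by (simp add: LIMSEQ_const_iff)
qed

lemma L2_continuous_compact:
  fixes v :: "'a::euclidean_space \<Rightarrow> real"
  assumes "continuous_on UNIV v" "compact K"
  shows "L2 K v"
proof -
  have m: "(\<lambda>x. indicator K x *\<^sub>R v x) \<in> borel_measurable borel"
    using assms by (intro borel_measurable_scaleR borel_measurable_indicator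
        borel_measurable_continuous_onI) (auto simp: borel_compact)
  have "integrable lborel (\<lambda>x. indicator K x *\<^sub>R (v x)\<^sup>2)"
    by (rule borel_integrable_compact[OF assms(2)])
      (use assms in \<open>auto intro!: continuous_intros intro: continuous_on_subset\<close>)
  then have "integrable lebesgue (\<lambda>x. indicator K x *\<^sub>R (v x)\<^sup>2)"
    by (metis borel_measurable_integrable integrable_completion)
  moreover have "(\<lambda>x. indicator K x *\<^sub>R v x) \<in> borel_measurable lebesgue"
    using m by (intro measurable_completion) simp
  ultimately show ?thesis
    unfolding L2_def set_borel_measurable_def set_integrable_def by blast
qed

lemma L2_subset:
  assumes "L2 S v" "T \<in> sets lebesgue" "T \<subseteq> S"
  shows "L2 T v"
  using assms unfolding L2_def set_borel_measurable_def[symmetric]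
  by (auto intro: set_integrable_subset set_borel_measurable_subset)

lemma test_function_dir_deriv:
  assumes "test_function \<Omega> \<eta>"
  shows "test_function \<Omega> (dir_deriv v \<eta>)"
proof -
  let ?S = "closure {z. \<eta> z \<noteq> 0}"
  have "dir_deriv v \<eta> z = 0" if "z \<notin> ?S" for z
  proof -
    have *: "0 = \<eta> y" if "y \<in> - ?S" for y
      using that closure_subset[of "{z. \<eta> z \<noteq> 0}"] by auto
    have "(\<eta> has_derivative (\<lambda>_. 0)) (at z)"
      by (rule has_derivative_transform_within_open[OF has_derivative_const open_Compl[OF closed_closure] _ *])
        (use that in simp)
    then show ?thesis unfolding dir_deriv_def by (metis frechet_derivative_at)
  qed
  then have "{z. dir_deriv v \<eta> z \<noteq> 0} \<subseteq> ?S" by auto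
  then have sub: "closure {z. dir_deriv v \<eta> z \<noteq> 0} \<subseteq> ?S" by (simp add: closure_minimal)
  have "Ck n (dir_deriv v \<eta>)" for n
    using assms Ck.simps(2)[of n \<eta>] unfolding test_function_def by blast
  moreover have "compact (closure {z. dir_deriv v \<eta> z \<noteq> 0})"
    using assms compact_Int_closed[of ?S "closure {z. dir_deriv v \<eta> z \<noteq> 0}"] Int_absorb1[OF sub]
    by (simp add: test_function_def)
  ultimately show ?thesis using assms sub unfolding test_function_def by auto
qed

lemma test_function_continuous: "test_function \<Omega> \<eta> \<Longrightarrow> continuous_on UNIV \<eta>"
  unfolding test_function_def using Ck.simps(1) by blast

lemma test_function_has_derivative_line:
  assumes "test_function \<Omega> \<eta>"
  shows "((\<lambda>s. \<eta> (z + s *\<^sub>R b)) has_real_derivative dir_deriv b \<eta> z) (at 0)"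
proof -
  have "\<eta> differentiable (at z)" using assms Ck.simps(2)[of 0 \<eta>] unfolding test_function_def by blast
  then have d: "(\<eta> has_derivative frechet_derivative \<eta> (at z)) (at z)" by (simp add: frechet_derivative_works)
  have "((\<lambda>s. \<eta> (z + s *\<^sub>R b)) has_derivative (\<lambda>s. frechet_derivative \<eta> (at z) (s *\<^sub>R b))) (at 0)"
    by (rule has_derivative_compose[of "\<lambda>s. z + s *\<^sub>R b" "\<lambda>s. s *\<^sub>R b", where g=\<eta>])
      (use d in \<open>auto intro!: derivative_eq_intros\<close>)
  then show ?thesis unfolding has_field_derivative_def dir_deriv_def
    using linear_scale[OF has_derivative_linear[OF d]] by (simp add: mult.commute[of _ "frechet_derivative \<eta> (at z) b"])
qed

lemma test_function_support:
  assumes "test_function \<Omega> \<eta>"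
  obtains K where "compact K" "K \<subseteq> \<Omega>" "\<And>z. z \<notin> K \<Longrightarrow> \<eta> z = 0"
proof
  show "compact (closure {z. \<eta> z \<noteq> 0})" "closure {z. \<eta> z \<noteq> 0} \<subseteq> \<Omega>"
    using assms by (auto simp: test_function_def)
  show "\<eta> z = 0" if "z \<notin> closure {z. \<eta> z \<noteq> 0}" for z
    using that closure_subset[of "{z. \<eta> z \<noteq> 0}"] by auto
qed

text \<open>Cutting \<open>\<phi>\<close> off outside \<open>\<Omega>\<close> gives back
  \<open>\<phi>\<close> itself, so the integrals of the weak formulation become plain integrals of
  continuous functions.\<close>

lemma set_lebesgue_integral_support:
  fixes \<phi> :: "'a::euclidean_space \<Rightarrow> real"
  assumes "continuous_on UNIV \<phi>" "\<And>z. z \<notin> \<Omega> \<Longrightarrow> \<phi> z = 0"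
  shows "(LINT z:\<Omega>|lebesgue. \<phi> z) = (LINT z|lborel. \<phi> z)"
proof -
  have "(\<lambda>z. indicator \<Omega> z *\<^sub>R \<phi> z) = \<phi>" using assms(2) by (auto simp: indicator_def fun_eq_iff)
  moreover have "\<phi> \<in> borel_measurable lborel" using assms(1) by (simp add: borel_measurable_continuous_onI)
  ultimately show ?thesis unfolding set_lebesgue_integral_def by (simp add: integral_completion)
qed

text \<open>Integration by parts: the derivative of \<open>v z * \<eta> z\<close> along
  \<open>b\<close> has integral 0, since this product has compact support. Asking only for a
  derivative along \<open>b\<close> lets the lemma also serve a merely continuous function that is
  constant in that direction.\<close>

lemma weak_deriv_continuous:
  fixes v :: "'a::euclidean_space \<Rightarrow> real"
  assumes "continuous_on UNIV v" "continuous_on UNIV w"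
    and der: "\<And>z. ((\<lambda>s. v (z + s *\<^sub>R b)) has_real_derivative w z) (at 0)"
  shows "weak_deriv \<Omega> b v w"
  unfolding weak_deriv_def
proof (intro conjI allI impI)
  fix K assume "compact K \<and> K \<subseteq> \<Omega>"
  then have "compact K" ..
  then show "L2 K v" "L2 K w"
    using assms(1,2) L2_continuous_compact by blast+
next
  fix \<eta> assume \<eta>: "test_function \<Omega> \<eta>"
  let ?D = "dir_deriv b \<eta>"
  note D = test_function_dir_deriv[OF \<eta>, of b]
  note cont = assms(1,2) test_function_continuous[OF \<eta>] test_function_continuous[OF D]
  obtain K where K: "compact K" "K \<subseteq> \<Omega>" "\<And>z. z \<notin> K \<Longrightarrow> \<eta> z = 0" using test_function_support[OF \<eta>] by metis
  obtain K' where K': "compact K'" "K' \<subseteq> \<Omega>" "\<And>z. z \<notin> K' \<Longrightarrow> ?D z = 0" using test_function_support[OF D] by metis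
  have "(LINT z|lborel. v z * ?D z + w z * \<eta> z) = 0"
  proof (rule integral_directional_derivative_eq_0[of "\<lambda>z. v z * \<eta> z" b _ K])
    fix z
    show "((\<lambda>s. v (z + s *\<^sub>R b) * \<eta> (z + s *\<^sub>R b)) has_real_derivative v z * ?D z + w z * \<eta> z) (at 0)"
      using DERIV_mult[OF der test_function_has_derivative_line[OF \<eta>, of z b], of z] by (simp add: algebra_simps)
  qed (use K cont in \<open>auto intro!: continuous_intros\<close>)
  moreover have "integrable lborel (\<lambda>z. v z * ?D z)"
    by (rule continuous_compact_support_integrable[of _ K']) (use K' cont in \<open>auto intro!: continuous_intros\<close>)
  moreover have "integrable lborel (\<lambda>z. w z * \<eta> z)"
    by (rule continuous_compact_support_integrable[of _ K]) (use K cont in \<open>auto intro!: continuous_intros\<close>)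
  moreover have "(LINT z:\<Omega>|lebesgue. v z * ?D z) = (LINT z|lborel. v z * ?D z)"
    by (rule set_lebesgue_integral_support) (use K' cont in \<open>auto intro!: continuous_intros\<close>)
  moreover have "(LINT z:\<Omega>|lebesgue. w z * \<eta> z) = (LINT z|lborel. w z * \<eta> z)"
    by (rule set_lebesgue_integral_support) (use K cont in \<open>auto intro!: continuous_intros\<close>)
  ultimately show "(LINT z:\<Omega>|lebesgue. v z * ?D z) = - (LINT z:\<Omega>|lebesgue. w z * \<eta> z)" by simp
qed

text \<open>The cut-off makes the product compactly supported, so the function and its derivatives
  from the product rule are continuous with compact support, and those are square integrable on
  every measurable set.\<close>

lemma H1_loc_continuous:
  fixes v :: "'a::euclidean_space \<Rightarrow> real"
  assumes v: "continuous_on UNIV v" and w: "\<And>b. b \<in> Basis \<Longrightarrow> continuous_on UNIV (w b)"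
    and der: "\<And>b z. b \<in> Basis \<Longrightarrow> ((\<lambda>s. v (z + s *\<^sub>R b)) has_real_derivative w b z) (at 0)"
    and \<Omega>: "\<Omega> \<in> sets lebesgue"
  shows "H1_loc \<Omega> v"
  unfolding H1_loc_def
proof (intro allI impI)
  fix \<psi> :: "'a \<Rightarrow> real" assume \<psi>: "test_function UNIV \<psi>"
  \<comment> \<open>\<open>\<Omega>\<close> need not be bounded, so square integrability is first
    passed from \<open>K\<close> to the whole space, where \<open>\<phi>\<close> vanishes off
    \<open>K\<close>, and then restricted to \<open>\<Omega>\<close>.\<close>
  have L: "L2 \<Omega> \<phi>" if "continuous_on UNIV \<phi>" "compact K" "\<And>z. z \<notin> K \<Longrightarrow> \<phi> z = 0" for \<phi> K
  proof -
    have "L2 K \<phi>" by (rule L2_continuous_compact) (use that in auto)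
    moreover have "(\<lambda>z. indicator K z *\<^sub>R \<phi> z) = \<phi>" "(\<lambda>z. indicator K z *\<^sub>R (\<phi> z)\<^sup>2) = (\<lambda>z. (\<phi> z)\<^sup>2)"
      using that(3) by (auto simp: indicator_def fun_eq_iff)
    ultimately have "L2 UNIV \<phi>" by (simp add: L2_def set_borel_measurable_def set_integrable_def)
    then show ?thesis using \<Omega> by (rule L2_subset) auto
  qed
  obtain K where K: "compact K" "\<And>z. z \<notin> K \<Longrightarrow> \<psi> z = 0" using test_function_support[OF \<psi>] by metis
  note c\<psi> = test_function_continuous[OF \<psi>]
  show "H1 \<Omega> (\<lambda>z. \<psi> z * v z)"
    unfolding H1_def
  proof (intro conjI ballI exI)
    show "L2 \<Omega> (\<lambda>z. \<psi> z * v z)"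
      by (rule L[OF _ K(1)]) (use K v c\<psi> in \<open>auto intro!: continuous_intros\<close>)
    fix b :: 'a assume b: "b \<in> Basis"
    note D = test_function_dir_deriv[OF \<psi>, of b]
    obtain K' where K': "compact K'" "\<And>z. z \<notin> K' \<Longrightarrow> dir_deriv b \<psi> z = 0" using test_function_support[OF D] by metis
    let ?w = "\<lambda>z. \<psi> z * w b z + dir_deriv b \<psi> z * v z"
    have c: "continuous_on UNIV ?w"
      using v w[OF b] c\<psi> test_function_continuous[OF D] by (intro continuous_intros)
    show "L2 \<Omega> ?w"
      by (rule L[of _ "K \<union> K'"]) (use c K K' in auto)
    show "weak_deriv \<Omega> b (\<lambda>z. \<psi> z * v z) ?w"
    proof (rule weak_deriv_continuous)
      fix z
      show "((\<lambda>s. \<psi> (z + s *\<^sub>R b) * v (z + s *\<^sub>R b)) has_real_derivative ?w z) (at 0)"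
        using DERIV_mult[OF test_function_has_derivative_line[OF \<psi>, of z b] der[OF b, of z]] by (simp add: algebra_simps)
    qed (use c v c\<psi> in \<open>auto intro!: continuous_intros\<close>)
  qed
qed

section \<open>Travelling waves\<close>

lemma dir_deriv_linear:
  assumes "test_function \<Omega> \<eta>"
  shows "dir_deriv (v + c *\<^sub>R w) \<eta> z = dir_deriv v \<eta> z + c * dir_deriv w \<eta> z"
proof -
  have "\<eta> differentiable (at z)" using assms Ck.simps(2)[of 0 \<eta>] unfolding test_function_def by blast
  then have "linear (frechet_derivative \<eta> (at z))" by (rule linear_frechet_derivative)
  then show ?thesis by (simp add: dir_deriv_def linear_add linear_scale)
qed

lemma test_function_set_integrable:
  fixes v :: "'a::euclidean_space \<Rightarrow> real"
  assumes "continuous_on UNIV v" "test_function \<Omega> \<eta>"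
  shows "set_integrable lebesgue \<Omega> (\<lambda>z. v z * \<eta> z)"
proof -
  obtain K where K: "compact K" "K \<subseteq> \<Omega>" "\<And>z. z \<notin> K \<Longrightarrow> \<eta> z = 0"
    using test_function_support[OF assms(2)] by metis
  have "integrable lborel (\<lambda>z. v z * \<eta> z)"
    by (rule continuous_compact_support_integrable[of _ K])
      (use K assms(1) test_function_continuous[OF assms(2)] in \<open>auto intro!: continuous_intros\<close>)
  then have "integrable lebesgue (\<lambda>z. v z * \<eta> z)"
    by (metis borel_measurable_integrable integrable_completion)
  also have "(\<lambda>z. v z * \<eta> z) = (\<lambda>z. indicator \<Omega> z *\<^sub>R (v z * \<eta> z))"
    using K by (auto simp: indicator_def fun_eq_iff)
  finally show ?thesis by (simp add: set_integrable_def)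
qed

lemma DERIV_compose_eq:
  assumes "\<And>x. (F has_real_derivative h x) (at x)"
    and "(g has_real_derivative d) (at s)" "h (g s) * d = e"
  shows "((\<lambda>s. F (g s)) has_real_derivative e) (at s)"
  using DERIV_chain2[OF assms(1,2)] assms(3) by simp

text \<open>\<open>F\<close> comes with only one derivative, so just one of the two derivatives on
  \<open>\<eta>\<close> is moved onto the wave, in \<open>t\<close> and in \<open>x\<close>
  separately. What remains is a first order identity for \<open>h\<close>, which is transported
  along a characteristic.\<close>

lemma wave_equation_travelling_wave:
  fixes F h :: "real \<Rightarrow> real"
  assumes h: "continuous_on UNIV h" and F: "\<And>x. (F has_real_derivative h x) (at x)"
    and c: "c * c = (1::real)"
  shows "wave_equation \<Omega> (\<lambda>z. F (snd z + c * fst z))"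
  unfolding wave_equation_def
proof (intro allI impI)
  fix \<eta> :: "real \<times> real \<Rightarrow> real" assume \<eta>: "test_function \<Omega> \<eta>"
  let ?G = "\<lambda>z. F (snd z + c * fst z)" and ?H = "\<lambda>z. h (snd z + c * fst z)"
  let ?t = "dir_deriv (0, 1)" and ?x = "dir_deriv (1, 0)"
  note D = test_function_dir_deriv
  have contF: "continuous_on UNIV F"
    using F by (meson DERIV_continuous_on has_field_derivative_at_within)
  have G: "continuous_on UNIV ?G"
    by (rule continuous_on_compose2[OF contF]) (auto intro!: continuous_intros)
  have H: "continuous_on UNIV ?H"
    by (rule continuous_on_compose2[OF h]) (auto intro!: continuous_intros)
  have "weak_deriv \<Omega> (0, 1) ?G ?H"
    by (rule weak_deriv_continuous[OF G H]) (auto intro!: derivative_eq_intros DERIV_compose_eq[OF F])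
  then have 1: "(LINT z:\<Omega>|lebesgue. ?G z * ?t (?t \<eta>) z) = - (LINT z:\<Omega>|lebesgue. ?H z * ?t \<eta> z)"
    using D[OF \<eta>] unfolding weak_deriv_def by blast
  have "weak_deriv \<Omega> (1, 0) ?G (\<lambda>z. c * ?H z)"
    by (rule weak_deriv_continuous[OF G]) (auto intro!: derivative_eq_intros DERIV_compose_eq[OF F] continuous_intros H)
  then have "(LINT z:\<Omega>|lebesgue. ?G z * ?x (?x \<eta>) z) = - (LINT z:\<Omega>|lebesgue. (c * ?H z) * ?x \<eta> z)"
    using D[OF \<eta>] unfolding weak_deriv_def by blast
  then have 2: "(LINT z:\<Omega>|lebesgue. ?G z * ?x (?x \<eta>) z) = - c * (LINT z:\<Omega>|lebesgue. ?H z * ?x \<eta> z)"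
    by (simp add: mult.assoc)
  \<comment> \<open>\<open>h\<close> need not be differentiable, but the wave is constant along \<open>(-c, 1)\<close>.\<close>
  have "(\<lambda>s. ?H (z + s *\<^sub>R (- c, 1))) = (\<lambda>s. ?H z)" for z
    using c by (simp add: algebra_simps mult.assoc[symmetric])
  then have "weak_deriv \<Omega> (- c, 1) ?H (\<lambda>_. 0)"
    by (intro weak_deriv_continuous[OF H]) auto
  then have "(LINT z:\<Omega>|lebesgue. ?H z * dir_deriv (- c, 1) \<eta> z) = 0"
    using \<eta> unfolding weak_deriv_def by (auto simp: set_lebesgue_integral_def)
  moreover have "dir_deriv (- c, 1) \<eta> z = ?t \<eta> z - c * ?x \<eta> z" for z
    using dir_deriv_linear[OF \<eta>, of "(0, 1)" "- c" "(1, 0)" z] by simp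
  ultimately have "0 = (LINT z:\<Omega>|lebesgue. ?H z * ?t \<eta> z - c * (?H z * ?x \<eta> z))"
    by (simp add: algebra_simps)
  also have "\<dots> = (LINT z:\<Omega>|lebesgue. ?H z * ?t \<eta> z) - c * (LINT z:\<Omega>|lebesgue. ?H z * ?x \<eta> z)"
    using test_function_set_integrable[OF H D[OF \<eta>]]
    by (subst set_integral_diff(2)) auto
  finally have 3: "(LINT z:\<Omega>|lebesgue. ?H z * ?t \<eta> z) = c * (LINT z:\<Omega>|lebesgue. ?H z * ?x \<eta> z)" by simp
  have "(LINT z:\<Omega>|lebesgue. ?G z * (?t (?t \<eta>) z - ?x (?x \<eta>) z))
      = (LINT z:\<Omega>|lebesgue. ?G z * ?t (?t \<eta>) z) - (LINT z:\<Omega>|lebesgue. ?G z * ?x (?x \<eta>) z)"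
    using test_function_set_integrable[OF G D[OF D[OF \<eta>]]]
    by (subst set_integral_diff(2)[symmetric]) (auto simp: algebra_simps)
  then show "(LINT z:\<Omega>|lebesgue. ?G z * (?t (?t \<eta>) z - ?x (?x \<eta>) z)) = 0"
    using 1 2 3 by simp
qed

lemma wave_equation_add:
  assumes "continuous_on UNIV u" "continuous_on UNIV v" "wave_equation \<Omega> u" "wave_equation \<Omega> v"
  shows "wave_equation \<Omega> (\<lambda>z. u z + v z)"
  unfolding wave_equation_def
proof (intro allI impI)
  fix \<eta> :: "real \<times> real \<Rightarrow> real" assume \<eta>: "test_function \<Omega> \<eta>"
  let ?t = "dir_deriv (0, 1) (dir_deriv (0, 1) \<eta>)" and ?x = "dir_deriv (1, 0) (dir_deriv (1, 0) \<eta>)"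
  note D = test_function_dir_deriv[OF test_function_dir_deriv[OF \<eta>]]
  have i: "set_integrable lebesgue \<Omega> (\<lambda>z. w z * (?t z - ?x z))" if "continuous_on UNIV w" for w
    unfolding right_diff_distrib
    by (intro set_integral_diff(1) test_function_set_integrable that D)
  show "(LINT z:\<Omega>|lebesgue. (u z + v z) * (?t z - ?x z)) = 0"
    unfolding distrib_right
    using assms \<eta> by (subst set_integral_add(2)[OF i i]) (auto simp: wave_equation_def)
qed

lemma open_Q: "open (Q k)"
proof -
  have "Q k = {z. 0 < fst z} \<inter> {z. fst z < 1 + k * snd z} \<inter> {z. 0 < snd z}"
    by (auto simp: Q_def len_def)
  also have "open \<dots>"
    by (intro open_Int open_Collect_less continuous_intros)
  finally show ?thesis .
qed

section \<open>Weak solutions built from a continuous profile\<close>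

lemma H1_continuous_interval:
  fixes v :: "real \<Rightarrow> real"
  assumes "continuous_on UNIV v" "continuous_on UNIV w" "\<And>x. (v has_real_derivative w x) (at x)"
  shows "H1 {a<..<b} v"
proof -
  have L: "L2 {a<..<b} f" if "continuous_on UNIV f" for f :: "real \<Rightarrow> real"
    by (rule L2_subset[OF L2_continuous_compact[OF that compact_Icc[of a b]]]) auto
  have "((\<lambda>s. v (z + s)) has_real_derivative w z) (at 0)" for z
    using assms(3)[of z] DERIV_shift[of v "w z" 0 z] by (simp add: add.commute)
  then have "weak_deriv {a<..<b} 1 v w"
    using assms by (intro weak_deriv_continuous) auto
  then show ?thesis unfolding H1_def using L assms by auto
qed

text \<open>Taking one antiderivative \<open>F\<close> of \<open>h\<close> for both travelling waves
  makes \<open>u_x\<close> vanish at \<open>x = 0\<close> identically; \<open>bc\<close> is the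
  condition at the moving end. The initial data are simply read off from \<open>F\<close> and
  \<open>h\<close>.\<close>

lemma ex_weak_solution:
  fixes h :: "real \<Rightarrow> real"
  assumes h: "continuous_on UNIV h"
    and bc: "\<And>t. t > 0 \<Longrightarrow> (1 + a) * h ((1 + k) * t + 1) = (1 - a) * h ((1 - k) * t - 1)"
  shows "\<exists>u0 u1 u. weak_solution k a u0 u1 u (\<lambda>(x, t). h (t + x) - h (t - x)) (\<lambda>(x, t). h (t + x) + h (t - x))"
proof -
  \<comment> \<open>The antiderivative must exist on the whole line, hence the interval with
    infinite end points.\<close>
  have "\<exists>F. \<forall>x::real. - \<infinity> < ereal x \<longrightarrow> ereal x < \<infinity> \<longrightarrow> (F has_vector_derivative h x) (at x)"
    using h by (intro einterval_antiderivative) (auto simp: continuous_on_eq_continuous_at)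
  then obtain F where F: "(F has_real_derivative h x) (at x)" for x
    by (auto simp: has_real_derivative_iff_has_vector_derivative)
  have contF: "continuous_on UNIV F"
    using F by (meson DERIV_continuous_on has_field_derivative_at_within)
  note c = continuous_intros continuous_on_compose2[OF contF] continuous_on_compose2[OF h]
  \<comment> \<open>The factors \<open>1\<close> and \<open>-1\<close> are written out as the two
    values of \<open>c\<close> in \<open>wave_equation_travelling_wave\<close>.\<close>
  define u where "u = (\<lambda>z. F (snd z + 1 * fst z) + F (snd z + (-1) * fst z))"
  have cu: "continuous_on UNIV u" unfolding u_def by (auto intro!: c)
  have "wave_equation (Q k) u" unfolding u_def
    by (intro wave_equation_add wave_equation_travelling_wave[OF h F]) (auto intro!: c)
  moreover have "H1_loc (Q k) u"
  proof (rule H1_loc_continuous[OF cu])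
    let ?w = "\<lambda>b z. (snd b + fst b) * h (snd z + fst z) + (snd b - fst b) * h (snd z - fst z)"
    show "continuous_on UNIV (?w b)" for b by (auto intro!: c)
    show "((\<lambda>s. u (z + s *\<^sub>R b)) has_real_derivative ?w b z) (at 0)" for b z
      unfolding u_def by (auto intro!: derivative_eq_intros DERIV_compose_eq[OF F] simp: algebra_simps)
    show "Q k \<in> sets lebesgue" using open_Q[of k] by (simp add: borel_open sets_completionI_sets)
  qed
  moreover have "((\<lambda>s. F (z + s)) has_real_derivative h z) (at 0)" for z
    using F[of z] DERIV_shift[of F "h z" 0 z] by (simp add: add.commute)
  then have "H1_loc UNIV F" "weak_deriv UNIV 1 F h"
    using contF h by (auto intro!: H1_loc_continuous[where w="\<lambda>b. h"] weak_deriv_continuous)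
  moreover have "H1 {0<..<1} (\<lambda>x. F x + F (- x))"
    by (rule H1_continuous_interval[where w="\<lambda>x. h x - h (- x)"])
      (auto intro!: c derivative_eq_intros DERIV_compose_eq[OF F])
  moreover have "L2 {0<..<1} (\<lambda>x. h x + h (- x))"
    by (rule L2_subset[OF L2_continuous_compact[OF _ compact_Icc[of 0 1]]]) (auto intro!: c)
  moreover have "h (t + len k t) - h (t - len k t) + a * (h (t + len k t) + h (t - len k t)) = 0" if "t > 0" for t
  proof -
    have "t + len k t = (1 + k) * t + 1" "t - len k t = (1 - k) * t - 1" by (simp_all add: len_def algebra_simps)
    then show ?thesis using bc[OF that] by (simp add: algebra_simps)
  qed
  ultimately have "weak_solution k a (\<lambda>x. F x + F (- x)) (\<lambda>x. h x + h (- x)) u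
      (\<lambda>(x, t). h (t + x) - h (t - x)) (\<lambda>(x, t). h (t + x) + h (t - x))"
    unfolding weak_solution_def
    by (intro conjI exI[of _ F] exI[of _ h]) (auto simp: u_def)
  then show ?thesis by blast
qed

section \<open>The weighted energy of a profile\<close>

lemma has_integral_affine_Icc:
  fixes f :: "real \<Rightarrow> real"
  assumes "m > 0" "f integrable_on {m * u + c..m * v + c}"
  shows "((\<lambda>x. m * f (m * x + c)) has_integral integral {m * u + c..m * v + c} f) {u..v}"
proof -
  have "(f has_integral integral {m * u + c..m * v + c} f) (cbox (m * u + c) (m * v + c))"
    using integrable_integral[OF assms(2)] by simp
  from has_integral_affinity'[OF this assms(1), of c]
  have "((\<lambda>x. f (m * x + c)) has_integral integral {m * u + c..m * v + c} f / m) {u..v}"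
    using assms(1) by (simp add: field_simps)
  from has_integral_mult_right[OF this, of m] show ?thesis using assms(1) by simp
qed

text \<open>This is the Leibniz rule in integrated form: what enters at the right end minus what
  leaves at the left end, each rewritten by an affine substitution. An integrable \<open>f\<close>
  gives no pointwise derivative in time, so the rule is stated through
  \<open>has_integral\<close>.\<close>

lemma has_integral_moving_interval:
  fixes f :: "real \<Rightarrow> real"
  assumes k: "0 < k" "k < 1" and st: "0 \<le> s" "s \<le> t"
    and f: "\<And>x y. -1 \<le> x \<Longrightarrow> f integrable_on {x..y}"
  shows "((\<lambda>\<tau>. (1 + k) * f ((1 + k) * \<tau> + 1) - (1 - k) * f ((1 - k) * \<tau> - 1)) has_integral
    integral {(1 - k) * t - 1..(1 + k) * t + 1} f - integral {(1 - k) * s - 1..(1 + k) * s + 1} f) {s..t}"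
proof -
  define \<alpha> \<beta> where "\<alpha> \<tau> = (1 - k) * \<tau> + -1" and "\<beta> \<tau> = (1 + k) * \<tau> + 1" for \<tau>
  have \<alpha>: "-1 \<le> \<alpha> s" "\<alpha> s \<le> \<alpha> t" and \<beta>: "\<beta> s \<le> \<beta> t"
    using k st by (auto simp: \<alpha>_def \<beta>_def intro!: mult_left_mono)
  have \<alpha>\<beta>: "\<alpha> \<tau> \<le> \<beta> \<tau>" if "0 \<le> \<tau>" for \<tau>
    using k that by (simp add: \<alpha>_def \<beta>_def algebra_simps add_increasing)
  \<comment> \<open>The hull \<open>{\<alpha> s..\<beta> t}\<close> is split once at
    \<open>\<alpha> t\<close> and once at \<open>\<beta> s\<close>; this works whichever of these
    two points is the larger.\<close>
  have "integral {\<alpha> s..\<alpha> t} f + integral {\<alpha> t..\<beta> t} f = integral {\<alpha> s..\<beta> t} f"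
    using \<alpha> \<alpha>\<beta>[of t] st f by (intro Henstock_Kurzweil_Integration.integral_combine) auto
  moreover have "integral {\<alpha> s..\<beta> s} f + integral {\<beta> s..\<beta> t} f = integral {\<alpha> s..\<beta> t} f"
    using \<alpha> \<beta> \<alpha>\<beta>[of s] st f by (intro Henstock_Kurzweil_Integration.integral_combine) auto
  ultimately have eq: "integral {\<beta> s..\<beta> t} f - integral {\<alpha> s..\<alpha> t} f =
      integral {\<alpha> t..\<beta> t} f - integral {\<alpha> s..\<beta> s} f"
    by linarith
  have "f integrable_on {\<beta> s..\<beta> t}" "f integrable_on {\<alpha> s..\<alpha> t}"
    using \<alpha> \<alpha>\<beta>[of s] st by (auto intro!: f)
  then have "((\<lambda>\<tau>. (1 + k) * f (\<beta> \<tau>) - (1 - k) * f (\<alpha> \<tau>)) has_integral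
      integral {\<beta> s..\<beta> t} f - integral {\<alpha> s..\<alpha> t} f) {s..t}"
    unfolding \<alpha>_def \<beta>_def using k by (intro has_integral_diff has_integral_affine_Icc) auto
  then show ?thesis unfolding eq by (simp add: \<alpha>_def \<beta>_def)
qed

text \<open>The conditions that a weak solution imposes on \<open>h = g'\<close> after
  \<open>f'\<close> has been eliminated. The reflection law stays multiplied out, so that
  \<open>a = 1\<close> and \<open>a = -1\<close> are covered.\<close>

definition reflecting_profile :: "real \<Rightarrow> real \<Rightarrow> (real \<Rightarrow> real) \<Rightarrow> bool" where
  "reflecting_profile k a h \<longleftrightarrow> (\<forall>x y. (\<lambda>z. (h z)\<^sup>2) integrable_on {x..y}) \<and>
     (AE t in lebesgue. t > 0 \<longrightarrow> (1 + a) * h ((1 + k) * t + 1) = (1 - a) * h ((1 - k) * t - 1))"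

text \<open>The two boundary lines meet at time \<open>- 1 / k\<close>; measured from there the
  domain is a cone and the weight is homogeneous. The exponent is real because the one that
  conserves the weighted energy is in general not an integer.\<close>

definition weighted_energy :: "real \<Rightarrow> real \<Rightarrow> (real \<Rightarrow> real) \<Rightarrow> real \<Rightarrow> real" where
  "weighted_energy j k h t = integral {(1 - k) * t - 1..(1 + k) * t + 1} (\<lambda>z. (z + 1 / k) powr j * (h z)\<^sup>2)"

definition growth_coeff :: "real \<Rightarrow> real \<Rightarrow> real \<Rightarrow> real" where
  "growth_coeff j k a = (1 + k) powr (j + 1) * (1 - a)\<^sup>2 - (1 - k) powr (j + 1) * (1 + a)\<^sup>2"

text \<open>Since \<open>1 / k > 1\<close>, the base of the power stays positive for
  \<open>z \<ge> -1\<close>, so the weight is bounded on the interval for either sign of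
  \<open>j\<close>. A nonnegative integrable \<open>g\<close> is absolutely integrable and stays so
  after multiplication by the weight.\<close>

lemma weighted_integrable:
  fixes g :: "real \<Rightarrow> real"
  assumes "0 < k" "k < 1" "g integrable_on {x..y}" "\<And>z. 0 \<le> g z" "-1 \<le> x"
  shows "(\<lambda>z. (z + 1 / k) powr j * g z) integrable_on {x..y}"
proof -
  have "1 < 1 / k" using assms by simp
  then have "continuous_on {x..y} (\<lambda>z. (z + 1 / k) powr j)"
    using assms(5) by (intro continuous_intros ballI) (auto simp: less_le_not_le)
  then have "(\<lambda>z. (z + 1 / k) powr j * g z) absolutely_integrable_on {x..y}"
    using assms by (intro absolutely_integrable_bounded_measurable_product_real)
      (auto intro!: continuous_imp_measurable_on_sets_lebesgue compact_imp_bounded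
        compact_continuous_image nonnegative_absolutely_integrable_1)
  then show ?thesis by (rule set_lebesgue_integral_eq_integral)
qed

text \<open>The rate of change is a boundary term in the values of \<open>h\<close> at the two ends.
  The reflection law ties these values together and turns the term into
  \<open>growth_coeff j k a\<close> times a nonnegative function \<open>G\<close>.\<close>

lemma weighted_energy_mono:
  assumes k: "0 < k" "k < 1" and h: "reflecting_profile k a h" and st: "0 \<le> s" "s \<le> t"
  shows "0 \<le> growth_coeff j k a \<Longrightarrow> weighted_energy j k h s \<le> weighted_energy j k h t"
    and "growth_coeff j k a \<le> 0 \<Longrightarrow> weighted_energy j k h t \<le> weighted_energy j k h s"
proof -
  let ?W = "weighted_energy j k h" and ?P = "growth_coeff j k a"
  define A B where "A \<tau> = (h ((1 - k) * \<tau> - 1))\<^sup>2" and "B \<tau> = (h ((1 + k) * \<tau> + 1))\<^sup>2" for \<tau>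
  \<comment> \<open>The reflection law makes \<open>A\<close> and \<open>B\<close> common multiples
    of \<open>(1 + a)^2\<close> and \<open>(1 - a)^2\<close>. These two squares add up to
    \<open>2 * (1 + a^2)\<close>, so the common factor is \<open>(A + B) / (2 * (1 + a^2))\<close>,
    with no division by \<open>1 + a\<close> or \<open>1 - a\<close>.\<close>
  define G where "G \<tau> = (\<tau> + 1 / k) powr j * (A \<tau> + B \<tau>) / (2 * (1 + a\<^sup>2))" for \<tau>
  obtain N where N: "negligible N" "\<And>\<tau>. \<tau> > 0 \<Longrightarrow> \<tau> \<notin> N \<Longrightarrow>
      (1 + a) * h ((1 + k) * \<tau> + 1) = (1 - a) * h ((1 - k) * \<tau> - 1)"
    using h unfolding reflecting_profile_def eventually_ae_filter_negligible by blast
  have pos: "0 < 1 + a\<^sup>2" by (simp add: add_pos_nonneg)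
  have eq: "?P * G \<tau> = (1 + k) * (((1 + k) * \<tau> + 1 + 1 / k) powr j * B \<tau>)
      - (1 - k) * (((1 - k) * \<tau> - 1 + 1 / k) powr j * A \<tau>)" if \<tau>: "\<tau> > 0" "\<tau> \<notin> N" for \<tau>
  proof -
    define T where "T = \<tau> + 1 / k"
    have T: "T > 0" using \<tau> k by (simp add: T_def add_pos_pos)
    have sh: "(1 + k) * \<tau> + 1 + 1 / k = (1 + k) * T" "(1 - k) * \<tau> - 1 + 1 / k = (1 - k) * T"
      using k by (simp_all add: T_def field_simps)
    have AB: "(1 + a)\<^sup>2 * B \<tau> = (1 - a)\<^sup>2 * A \<tau>"
      using N(2)[OF \<tau>] by (simp add: A_def B_def flip: power_mult_distrib)
    \<comment> \<open>The speeds \<open>1 + k\<close> and \<open>1 - k\<close> of the end points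
      merge with the powers of the weight, which explains the exponent \<open>j + 1\<close>.\<close>
    define p q where "p = (1 + k) powr (j + 1)" and "q = (1 - k) powr (j + 1)"
    have pq: "(1 + k) * (1 + k) powr j = p" "(1 - k) * (1 - k) powr j = q"
      using k by (simp_all add: p_def q_def powr_add)
    have "2 * (1 + a\<^sup>2) * (p * B \<tau> - q * A \<tau>) = (p * (1 - a)\<^sup>2 - q * (1 + a)\<^sup>2) * (A \<tau> + B \<tau>)"
      using AB by algebra
    then have "(p * (1 - a)\<^sup>2 - q * (1 + a)\<^sup>2) * (A \<tau> + B \<tau>) / (2 * (1 + a\<^sup>2)) = p * B \<tau> - q * A \<tau>"
      using pos by (simp add: field_simps)
    then have "T powr j * (p * B \<tau> - q * A \<tau>)
        = T powr j * ((p * (1 - a)\<^sup>2 - q * (1 + a)\<^sup>2) * (A \<tau> + B \<tau>) / (2 * (1 + a\<^sup>2)))"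
      by simp
    then have "?P * G \<tau> = T powr j * (p * B \<tau> - q * A \<tau>)"
      by (simp only: growth_coeff_def G_def flip: T_def p_def q_def) simp
    also have "\<dots> = (1 + k) * ((1 + k) powr j * T powr j * B \<tau>) - (1 - k) * ((1 - k) powr j * T powr j * A \<tau>)"
      by (simp flip: pq add: algebra_simps)
    finally show ?thesis using k T by (simp add: sh powr_mult)
  qed
  have "((\<lambda>\<tau>. ?P * G \<tau>) has_integral ?W t - ?W s) {s..t}"
  \<comment> \<open>The reflection law is known only for positive times outside \<open>N\<close>,
    while \<open>s\<close> may be 0.\<close>
  proof (rule has_integral_spike[of "insert 0 N"])
    show "negligible (insert 0 N)" using N by simp
    show "((\<lambda>\<tau>. (1 + k) * (((1 + k) * \<tau> + 1 + 1 / k) powr j * B \<tau>)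
      - (1 - k) * (((1 - k) * \<tau> - 1 + 1 / k) powr j * A \<tau>)) has_integral ?W t - ?W s) {s..t}"
      unfolding weighted_energy_def A_def B_def
      by (rule has_integral_moving_interval[OF k st, of "\<lambda>z. (z + 1 / k) powr j * (h z)\<^sup>2"])
        (use h k in \<open>auto simp: reflecting_profile_def intro!: weighted_integrable\<close>)
  qed (use eq st in auto)
  moreover have "0 \<le> G \<tau>" for \<tau> using pos by (simp add: G_def A_def B_def)
  ultimately show "0 \<le> ?P \<Longrightarrow> ?W s \<le> ?W t" "?P \<le> 0 \<Longrightarrow> ?W t \<le> ?W s"
    using has_integral_nonneg[of "\<lambda>\<tau>. ?P * G \<tau>" "?W t - ?W s" "{s..t}"]
      has_integral_nonneg[OF has_integral_neg, of "\<lambda>\<tau>. ?P * G \<tau>" "?W t - ?W s" "{s..t}"]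
    by (auto simp: mult_nonpos_nonneg)
qed

section \<open>Comparison of weighted and plain energy\<close>

lemma powr_bounds:
  fixes l r p :: real
  assumes "0 < l" "l \<le> r"
  obtains m M where "0 < m" "0 < M" "\<And>x. l \<le> x \<Longrightarrow> x \<le> r \<Longrightarrow> m \<le> x powr p \<and> x powr p \<le> M"
proof (cases "0 \<le> p")
  case True
  show ?thesis
    by (rule that[of "l powr p" "r powr p"]) (use assms True in \<open>auto intro!: powr_mono2\<close>)
next
  case False
  show ?thesis
    by (rule that[of "r powr p" "l powr p"]) (use assms False in \<open>auto intro!: powr_mono2'\<close>)
qed

text \<open>The shifted end points are exactly \<open>(1 - k) * T\<close> and
  \<open>(1 + k) * T\<close>, so on the interval the weight divided by \<open>T powr j\<close> stays
  between two positive constants. These are chosen before \<open>a\<close>, \<open>h\<close> and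
  \<open>t\<close>, as rates uniform in the initial data require.\<close>

lemma weighted_energy_bounds:
  assumes k: "0 < k" "k < 1"
  obtains m M where "0 < m" "0 < M"
    "\<And>a h t. reflecting_profile k a h \<Longrightarrow> 0 \<le> t \<Longrightarrow>
      m * (t + 1 / k) powr j * weighted_energy 0 k h t \<le> weighted_energy j k h t \<and>
      weighted_energy j k h t \<le> M * (t + 1 / k) powr j * weighted_energy 0 k h t"
proof -
  obtain m M where mM: "0 < m" "0 < M"
    "\<And>x. 1 - k \<le> x \<Longrightarrow> x \<le> 1 + k \<Longrightarrow> m \<le> x powr j \<and> x powr j \<le> M"
    using powr_bounds[of "1 - k" "1 + k" j] k by auto
  show ?thesis
  proof (rule that[OF mM(1,2)])
    fix a h t assume h: "reflecting_profile k a h" and t: "0 \<le> (t::real)"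
    let ?I = "{(1 - k) * t - 1..(1 + k) * t + 1}"
    define T where "T = t + 1 / k"
    have T: "T > 0" using t k by (simp add: T_def add_nonneg_pos)
    have int: "(\<lambda>z. (z + 1 / k) powr i * (h z)\<^sup>2) integrable_on ?I" for i
      using h k t by (intro weighted_integrable) (auto simp: reflecting_profile_def)
    have b: "m * T powr j * ((z + 1 / k) powr 0 * (h z)\<^sup>2) \<le> (z + 1 / k) powr j * (h z)\<^sup>2 \<and>
      (z + 1 / k) powr j * (h z)\<^sup>2 \<le> M * T powr j * ((z + 1 / k) powr 0 * (h z)\<^sup>2)" if z: "z \<in> ?I" for z
    proof -
      have "(1 - k) * T \<le> z + 1 / k" "z + 1 / k \<le> (1 + k) * T"
        using z k by (simp_all add: T_def algebra_simps diff_divide_distrib add_divide_distrib)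
      then have x: "1 - k \<le> (z + 1 / k) / T" "(z + 1 / k) / T \<le> 1 + k"
        using T by (simp_all add: field_simps)
      then have p: "0 < (z + 1 / k) / T" using k by linarith
      then have p': "0 < z + 1 / k" using T by (simp add: zero_less_divide_iff)
      have "(z + 1 / k) powr j = ((z + 1 / k) / T) powr j * T powr j"
        using p' T by (simp flip: powr_mult)
      then show ?thesis using mM(3)[OF x] p' by (auto intro!: mult_right_mono)
    qed
    have "weighted_energy j k h t \<le> integral ?I (\<lambda>z. M * T powr j * ((z + 1 / k) powr 0 * (h z)\<^sup>2))"
      unfolding weighted_energy_def
      by (rule integral_le[OF int integrable_on_mult_right[OF int]]) (use b in blast)
    moreover have "integral ?I (\<lambda>z. m * T powr j * ((z + 1 / k) powr 0 * (h z)\<^sup>2)) \<le> weighted_energy j k h t"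
      unfolding weighted_energy_def
      by (rule integral_le[OF integrable_on_mult_right[OF int] int]) (use b in blast)
    ultimately show "m * (t + 1 / k) powr j * weighted_energy 0 k h t \<le> weighted_energy j k h t \<and>
      weighted_energy j k h t \<le> M * (t + 1 / k) powr j * weighted_energy 0 k h t"
      unfolding weighted_energy_def[of 0] T_def[symmetric] by simp
  qed
qed

text \<open>The weighted energy is compared with the plain one at time 0 and at time
  \<open>t\<close>, and is monotone in between. Since \<open>T = (1 + k * t) / k\<close>, the factor
  \<open>(1 / k) powr j\<close> occurs on both sides and cancels; the two comparisons leave the
  constants \<open>m / M\<close> and \<open>M / m\<close>.\<close>

lemma profile_energy_rate:
  assumes k: "0 < k" "k < 1"
  obtains c C where "0 < c" "0 < C"
    "\<And>a h t. reflecting_profile k a h \<Longrightarrow> 0 \<le> t \<Longrightarrow> 0 \<le> growth_coeff j k a \<Longrightarrow>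
      c * (1 + k * t) powr (- j) * weighted_energy 0 k h 0 \<le> weighted_energy 0 k h t"
    "\<And>a h t. reflecting_profile k a h \<Longrightarrow> 0 \<le> t \<Longrightarrow> growth_coeff j k a \<le> 0 \<Longrightarrow>
      weighted_energy 0 k h t \<le> C * (1 + k * t) powr (- j) * weighted_energy 0 k h 0"
proof -
  let ?E = "weighted_energy 0 k" and ?W = "weighted_energy j k"
  obtain m M where mM: "0 < m" "0 < M"
    "\<And>a h t. reflecting_profile k a h \<Longrightarrow> 0 \<le> t \<Longrightarrow>
      m * (t + 1 / k) powr j * ?E h t \<le> ?W h t \<and> ?W h t \<le> M * (t + 1 / k) powr j * ?E h t"
    using weighted_energy_bounds[OF k, where j=j] by metis
  have sc: "(t + 1 / k) powr j = (1 / k) powr j * (1 + k * t) powr j" "0 < (1 + k * t) powr j"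
    "(1 + k * t) powr (- j) = 1 / (1 + k * t) powr j" if "0 \<le> t" for t
  proof -
    have "0 < 1 + k * t" using that k by (simp add: add_pos_nonneg)
    moreover have "t + 1 / k = (1 / k) * (1 + k * t)" using k by (simp add: field_simps)
    ultimately show "(t + 1 / k) powr j = (1 / k) powr j * (1 + k * t) powr j" "0 < (1 + k * t) powr j"
      using k by (simp_all only: powr_mult) simp_all
  qed (simp add: powr_minus_divide)
  have kj: "0 < (1 / k) powr j" using k by simp
  show ?thesis
  proof (rule that[of "m / M" "M / m"])
    fix a h t assume h: "reflecting_profile k a h" and t: "0 \<le> (t::real)"
    note b0 = mM(3)[OF h order_refl] and bt = mM(3)[OF h t]
    { assume "0 \<le> growth_coeff j k a"
      then have "m * (1 / k) powr j * ?E h 0 \<le> M * (t + 1 / k) powr j * ?E h t"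
        using weighted_energy_mono(1)[OF k h order_refl t, of j] b0 bt by simp
      then have "(1 / k) powr j * (m * ?E h 0) \<le> (1 / k) powr j * (M * (1 + k * t) powr j * ?E h t)"
        unfolding sc(1)[OF t] by (simp only: mult_ac)
      then have "m * ?E h 0 \<le> M * (1 + k * t) powr j * ?E h t"
        using kj by (simp only: mult_le_cancel_left_pos)
      then show "m / M * (1 + k * t) powr (- j) * ?E h 0 \<le> ?E h t"
        using mM(2) sc(2)[OF t] unfolding sc(3)[OF t] by (simp add: field_simps) }
    { assume "growth_coeff j k a \<le> 0"
      then have "m * (t + 1 / k) powr j * ?E h t \<le> M * (1 / k) powr j * ?E h 0"
        using weighted_energy_mono(2)[OF k h order_refl t, of j] b0 bt by simp
      then have "(1 / k) powr j * (m * (1 + k * t) powr j * ?E h t) \<le> (1 / k) powr j * (M * ?E h 0)"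
        unfolding sc(1)[OF t] by (simp only: mult_ac)
      then have "m * (1 + k * t) powr j * ?E h t \<le> M * ?E h 0"
        using kj by (simp only: mult_le_cancel_left_pos)
      then show "?E h t \<le> M / m * (1 + k * t) powr (- j) * ?E h 0"
        using mM(1) sc(2)[OF t] unfolding sc(3)[OF t] by (simp add: field_simps) }
  qed (use mM in auto)
qed

section \<open>Energy of weak solutions\<close>

text \<open>The profile is \<open>g'\<close>. At the fixed end \<open>f' = g'\<close> almost
  everywhere on the positive axis, which contains the argument \<open>t + l_k(t)\<close> of
  \<open>f'\<close> at the moving end. In the energy the mixed terms cancel, and the part of
  \<open>f'\<close> over \<open>[t, t + l]\<close> continues that of \<open>g'\<close> over
  \<open>[t - l, t]\<close>.\<close>

lemma weak_solution_reflecting_profile: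
  assumes k: "0 < k" "k < 1" and sol: "weak_solution k a u0 u1 u ux ut"
  obtains h where "reflecting_profile k a h" "\<And>t. 0 \<le> t \<Longrightarrow> energy k ux ut t = weighted_energy 0 k h t"
proof -
  obtain f g f' g' where wd: "weak_deriv UNIV 1 f f'" "weak_deriv UNIV 1 g g'"
    and ux: "ux = (\<lambda>(x, t). f' (t + x) - g' (t - x))"
    and ut: "ut = (\<lambda>(x, t). f' (t + x) + g' (t - x))"
    and bc0: "AE t in lebesgue. t > 0 \<longrightarrow> ux (0, t) = 0"
    and bc1: "AE t in lebesgue. t > 0 \<longrightarrow> ux (len k t, t) + a * ut (len k t, t) = 0"
    using sol unfolding weak_solution_def by blast
  have int: "(\<lambda>z. (f' z)\<^sup>2) integrable_on {x..y}" "(\<lambda>z. (g' z)\<^sup>2) integrable_on {x..y}" for x y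
  proof -
    have "L2 {x..y} f'" "L2 {x..y} g'" using wd unfolding weak_deriv_def by auto
    then show "(\<lambda>z. (f' z)\<^sup>2) integrable_on {x..y}" "(\<lambda>z. (g' z)\<^sup>2) integrable_on {x..y}"
      unfolding L2_def by (auto intro: set_lebesgue_integral_eq_integral)
  qed
  obtain N0 where N0: "negligible N0" "\<And>t. t > 0 \<Longrightarrow> t \<notin> N0 \<Longrightarrow> f' t = g' t"
    using bc0 unfolding eventually_ae_filter_negligible ux by auto
  obtain N1 where N1: "negligible N1" "\<And>t. t > 0 \<Longrightarrow> t \<notin> N1 \<Longrightarrow> ux (len k t, t) + a * ut (len k t, t) = 0"
    using bc1 unfolding eventually_ae_filter_negligible by auto
  have prof: "reflecting_profile k a g'"
    unfolding reflecting_profile_def eventually_ae_filter_negligible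
  \<comment> \<open>Replacing \<open>f'\<close> by \<open>g'\<close> at the moving end fails at most
    where \<open>(1 + k) * t + 1\<close> hits \<open>N0\<close>. This preimage is written as the
    image of \<open>N0\<close> under the inverse affine map, so that it is seen to be
    negligible.\<close>
  proof (intro conjI allI exI[of _ "N1 \<union> (\<lambda>y. (y - 1) / (1 + k)) ` N0"] subsetI)
    show "negligible (N1 \<union> (\<lambda>y. (y - 1) / (1 + k)) ` N0)"
      using N1(1) N0(1) k
      by (intro negligible_Un negligible_differentiable_image_negligible)
        (auto simp: differentiable_on_def divide_inverse intro!: derivative_intros)
    fix t assume t: "t \<in> {t. \<not> (t > 0 \<longrightarrow> (1 + a) * g' ((1 + k) * t + 1) = (1 - a) * g' ((1 - k) * t - 1))}"
    show "t \<in> N1 \<union> (\<lambda>y. (y - 1) / (1 + k)) ` N0"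
    proof (rule ccontr)
      assume "t \<notin> N1 \<union> (\<lambda>y. (y - 1) / (1 + k)) ` N0"
      then have n: "t \<notin> N1" and "t \<notin> (\<lambda>y. (y - 1) / (1 + k)) ` N0" by auto
      moreover have "t = ((1 + k) * t + 1 - 1) / (1 + k)" using k by simp
      ultimately have "(1 + k) * t + 1 \<notin> N0" by blast
      moreover have "0 < (1 + k) * t + 1" using t k by (auto intro!: add_pos_pos mult_pos_pos)
      ultimately have fg: "f' ((1 + k) * t + 1) = g' ((1 + k) * t + 1)" using N0(2) by blast
      have "t + len k t = (1 + k) * t + 1" "t - len k t = (1 - k) * t - 1"
        by (simp_all add: len_def algebra_simps)
      then show False using N1(2)[of t] n t fg by (simp add: ux ut) (simp add: algebra_simps)
    qed
  qed (rule int)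
  moreover have "energy k ux ut t = weighted_energy 0 k g' t" if t: "0 \<le> t" for t
  proof -
    define l where "l = len k t"
    have l: "0 \<le> l" "t - l = (1 - k) * t - 1" "t + l = (1 + k) * t + 1"
      using t k by (simp_all add: l_def len_def algebra_simps)
    have f_int: "((\<lambda>x. (f' (t + x))\<^sup>2) has_integral integral {t..t + l} (\<lambda>z. (f' z)\<^sup>2)) {0..l}"
      using has_integral_affine_Icc[of 1 "\<lambda>z. (f' z)\<^sup>2" 0 t l] int by (simp add: add.commute)
    have fg: "integral {t..t + l} (\<lambda>z. (f' z)\<^sup>2) = integral {t..t + l} (\<lambda>z. (g' z)\<^sup>2)"
      \<comment> \<open>The point 0 joins the exceptional set because the interval starts there when
        \<open>t = 0\<close>.\<close>
      by (rule integral_spike[of "insert 0 N0"]) (use N0 t in auto)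
    \<comment> \<open>The substitution \<open>z = t - x\<close> is a shift over
      \<open>{- l..0}\<close> followed by a reflection.\<close>
    have g_int: "((\<lambda>x. (g' (t - x))\<^sup>2) has_integral integral {t - l..t} (\<lambda>z. (g' z)\<^sup>2)) {0..l}"
      using has_integral_affine_Icc[of 1 "\<lambda>z. (g' z)\<^sup>2" "- l" t 0] int
        has_integral_reflect_real[of "\<lambda>x. (g' (t + x))\<^sup>2" _ 0 "- l"]
      by (simp add: add.commute)
    have "integral {t - l..t} (\<lambda>z. (g' z)\<^sup>2) + integral {t..t + l} (\<lambda>z. (g' z)\<^sup>2)
        = integral {t - l..t + l} (\<lambda>z. (g' z)\<^sup>2)"
      using l(1) int by (intro Henstock_Kurzweil_Integration.integral_combine) auto
    then have "integral {t..t + l} (\<lambda>z. (f' z)\<^sup>2) + integral {t - l..t} (\<lambda>z. (g' z)\<^sup>2)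
        = integral {t - l..t + l} (\<lambda>z. (g' z)\<^sup>2)"
      using fg by linarith
    with has_integral_add[OF f_int g_int]
    have "((\<lambda>x. (f' (t + x))\<^sup>2 + (g' (t - x))\<^sup>2) has_integral
        integral {t - l..t + l} (\<lambda>z. (g' z)\<^sup>2)) {0..l}"
      by (simp only:)
    then have "((\<lambda>x. 2 * ((f' (t + x))\<^sup>2 + (g' (t - x))\<^sup>2)) has_integral
        2 * integral {t - l..t + l} (\<lambda>z. (g' z)\<^sup>2)) {0..l}"
      by (rule has_integral_mult_right)
    moreover have "2 * ((f' (t + x))\<^sup>2 + (g' (t - x))\<^sup>2) = (ut (x, t))\<^sup>2 + (ux (x, t))\<^sup>2" for x
      by (simp add: ux ut power2_eq_square algebra_simps)
    ultimately have hi: "((\<lambda>x. (ut (x, t))\<^sup>2 + (ux (x, t))\<^sup>2) has_integral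
        2 * integral {t - l..t + l} (\<lambda>z. (g' z)\<^sup>2)) {0..l}"
      by simp
    then have "set_integrable lebesgue {0..l} (\<lambda>x. (ut (x, t))\<^sup>2 + (ux (x, t))\<^sup>2)"
      by (intro nonnegative_absolutely_integrable_1) auto
    from set_lebesgue_integral_eq_integral(2)[OF this] hi
    have "energy k ux ut t = integral {t - l..t + l} (\<lambda>z. (g' z)\<^sup>2)"
      by (simp add: energy_def l_def integral_unique)
    also have "\<dots> = weighted_energy 0 k g' t"
      unfolding weighted_energy_def l
    proof (rule Henstock_Kurzweil_Integration.integral_cong)
      fix z assume "z \<in> {(1 - k) * t - 1..(1 + k) * t + 1}"
      \<comment> \<open>The base must be nonzero: \<open>0 powr 0\<close> is 0, not 1.\<close>
      moreover have "0 \<le> (1 - k) * t" "1 < 1 / k" using t k by simp_all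
      ultimately have "0 < z + 1 / k" by simp
      then show "(g' z)\<^sup>2 = (z + 1 / k) powr 0 * (g' z)\<^sup>2" by simp
    qed
    finally show ?thesis .
  qed
  ultimately show ?thesis using that by blast
qed

lemma energy_mono:
  assumes k: "0 < k" "k < 1"
  shows "0 \<le> growth_coeff 0 k a \<Longrightarrow> energy_increasing k a"
    and "growth_coeff 0 k a \<le> 0 \<Longrightarrow> energy_decreasing k a"
proof -
  have "(0 \<le> growth_coeff 0 k a \<longrightarrow> energy k ux ut s \<le> energy k ux ut t) \<and>
      (growth_coeff 0 k a \<le> 0 \<longrightarrow> energy k ux ut t \<le> energy k ux ut s)"
    if sol: "weak_solution k a u0 u1 u ux ut" and st: "0 \<le> s" "s \<le> t" for u0 u1 u ux ut s t
  proof -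
    obtain h where "reflecting_profile k a h" "\<And>t. 0 \<le> t \<Longrightarrow> energy k ux ut t = weighted_energy 0 k h t"
      using weak_solution_reflecting_profile[OF k sol] by blast
    then show ?thesis
      using weighted_energy_mono[OF k, of a h s t 0] st by simp
  qed
  then show "0 \<le> growth_coeff 0 k a \<Longrightarrow> energy_increasing k a"
    "growth_coeff 0 k a \<le> 0 \<Longrightarrow> energy_decreasing k a"
    unfolding energy_increasing_def energy_decreasing_def by blast+
qed

lemma energy_rate:
  assumes k: "0 < k" "k < 1"
  obtains c C where "0 < c" "0 < C"
    "\<And>a u0 u1 u ux ut t. weak_solution k a u0 u1 u ux ut \<Longrightarrow> 0 \<le> t \<Longrightarrow> 0 \<le> growth_coeff j k a \<Longrightarrow>
      c * (1 + k * t) powr (- j) * energy k ux ut 0 \<le> energy k ux ut t"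
    "\<And>a u0 u1 u ux ut t. weak_solution k a u0 u1 u ux ut \<Longrightarrow> 0 \<le> t \<Longrightarrow> growth_coeff j k a \<le> 0 \<Longrightarrow>
      energy k ux ut t \<le> C * (1 + k * t) powr (- j) * energy k ux ut 0"
proof -
  obtain c C where cC: "0 < c" "0 < C"
    "\<And>a h t. reflecting_profile k a h \<Longrightarrow> 0 \<le> t \<Longrightarrow> 0 \<le> growth_coeff j k a \<Longrightarrow>
      c * (1 + k * t) powr (- j) * weighted_energy 0 k h 0 \<le> weighted_energy 0 k h t"
    "\<And>a h t. reflecting_profile k a h \<Longrightarrow> 0 \<le> t \<Longrightarrow> growth_coeff j k a \<le> 0 \<Longrightarrow>
      weighted_energy 0 k h t \<le> C * (1 + k * t) powr (- j) * weighted_energy 0 k h 0"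
    using profile_energy_rate[OF k, where j=j] by metis
  show ?thesis
  proof (rule that[OF cC(1,2)])
    fix a u0 u1 u ux ut and t :: real
    assume "weak_solution k a u0 u1 u ux ut" and t: "0 \<le> t"
    then obtain h where h: "reflecting_profile k a h" "\<And>t. 0 \<le> t \<Longrightarrow> energy k ux ut t = weighted_energy 0 k h t"
      using weak_solution_reflecting_profile[OF k] by blast
    show "0 \<le> growth_coeff j k a \<Longrightarrow> c * (1 + k * t) powr (- j) * energy k ux ut 0 \<le> energy k ux ut t"
      "growth_coeff j k a \<le> 0 \<Longrightarrow> energy k ux ut t \<le> C * (1 + k * t) powr (- j) * energy k ux ut 0"
      using cC(3,4)[OF h(1) t] h(2) t by simp_all
  qed
qed

section \<open>First order rates\<close>

lemma growth_coeff_1: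
  assumes "0 < k" "k < 1"
  shows "growth_coeff 1 k a = 4 * (k - a) * (1 - a * k)"
  \<comment> \<open>For \<open>j = 1\<close> the coefficient is a difference of two squares, with
    factors \<open>2 * (k - a)\<close> and \<open>2 * (1 - a * k)\<close>; its zeros are
    \<open>b1\<close> and \<open>b2\<close>.\<close>
  using assms by (simp add: growth_coeff_def power2_eq_square algebra_simps)

lemma first_order_rates:
  assumes k: "0 < k" "k < 1"
  shows "growth_coeff 1 k a \<le> 0 \<Longrightarrow> decays_no_less_than_order 1 k a"
    and "0 \<le> growth_coeff 1 k a \<Longrightarrow> decays_no_more_than_order 1 k a"
    and "growth_coeff 1 k a = 0 \<Longrightarrow> decays_only_at_order 1 k a"
proof -
  obtain c C where cC: "0 < c" "0 < C"
    "\<And>a u0 u1 u ux ut t. weak_solution k a u0 u1 u ux ut \<Longrightarrow> 0 \<le> t \<Longrightarrow> 0 \<le> growth_coeff 1 k a \<Longrightarrow>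
      c * (1 + k * t) powr (- 1) * energy k ux ut 0 \<le> energy k ux ut t"
    "\<And>a u0 u1 u ux ut t. weak_solution k a u0 u1 u ux ut \<Longrightarrow> 0 \<le> t \<Longrightarrow> growth_coeff 1 k a \<le> 0 \<Longrightarrow>
      energy k ux ut t \<le> C * (1 + k * t) powr (- 1) * energy k ux ut 0"
    using energy_rate[OF k, where j=1] by metis
  \<comment> \<open>The comparison polynomial is the length \<open>1 + k * t\<close> of the
    interval.\<close>
  have \<phi>: "rate_polynomial 1 [:1, k:]"
    using k by (auto simp: rate_polynomial_def add_pos_pos)
  have inv: "(1 + k * t) powr (- 1) = inverse (poly [:1, k:] t)" if "t > 0" for t
  proof -
    have "0 < 1 + k * t" using that k by (simp add: add_pos_pos)
    then show ?thesis by (simp add: powr_minus algebra_simps)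
  qed
  have lo: "c * inverse (poly [:1, k:] t) * energy k ux ut 0 \<le> energy k ux ut t"
    if "weak_solution k a u0 u1 u ux ut" "t > 0" "0 \<le> growth_coeff 1 k a" for u0 u1 u ux ut t
    using cC(3)[OF that(1) less_imp_le[OF that(2)] that(3)] unfolding inv[OF that(2)] .
  have hi: "energy k ux ut t \<le> C * energy k ux ut 0 * inverse (poly [:1, k:] t)"
    if "weak_solution k a u0 u1 u ux ut" "t > 0" "growth_coeff 1 k a \<le> 0" for u0 u1 u ux ut t
    using cC(4)[OF that(1) less_imp_le[OF that(2)] that(3)] unfolding inv[OF that(2)] by (simp only: mult_ac)
  show "growth_coeff 1 k a \<le> 0 \<Longrightarrow> decays_no_less_than_order 1 k a"
    unfolding decays_no_less_than_order_def using cC(2) \<phi> hi by blast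
  show "0 \<le> growth_coeff 1 k a \<Longrightarrow> decays_no_more_than_order 1 k a"
    unfolding decays_no_more_than_order_def using cC(1) \<phi> lo
    by (intro exI[of _ c] conjI exI[of _ "[:1, k:]"]) (auto simp: mult_ac)
  show "growth_coeff 1 k a = 0 \<Longrightarrow> decays_only_at_order 1 k a"
    unfolding decays_only_at_order_def using cC(1,2) \<phi> lo hi
    by (intro exI[of _ c] exI[of _ C] conjI exI[of _ "[:1, k:]"]) auto
qed

section \<open>Solutions with polynomial rates\<close>

text \<open>Supplies the witness for the degenerate parameters \<open>a = -1\<close> and
  \<open>a = 1\<close> in the final theorem.\<close>

lemma ex_zero_solution:
  "\<exists>u0 u1 u ux ut. weak_solution k a u0 u1 u ux ut \<and> (\<forall>t. energy k ux ut t = 0)"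
proof -
  obtain u0 u1 u where "weak_solution k a u0 u1 u (\<lambda>(x, t). 0) (\<lambda>(x, t). 0)"
    using ex_weak_solution[of "\<lambda>_. 0" a k] by auto
  moreover have "energy k (\<lambda>(x, t). 0) (\<lambda>(x, t). 0) t = 0" for t
    by (simp add: energy_def set_lebesgue_integral_def)
  ultimately show ?thesis by blast
qed

text \<open>In the variable \<open>z = y + 1 / k\<close> the condition at the moving end reads
  \<open>H (\<rho> * z) = c * H z\<close>. The power \<open>z powr q\<close> with
  \<open>\<rho> powr q = \<bar>c\<bar>\<close> solves it up to sign, and a cosine of the logarithm
  supplies the sign.\<close>

lemma ex_self_similar_profile:
  fixes k a :: real
  assumes k: "0 < k" "k < 1" and a: "a \<noteq> 1" "a \<noteq> -1"
  obtains h where "continuous_on UNIV h" "h (- 1) \<noteq> (0::real)"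
    "\<And>t. t > 0 \<Longrightarrow> (1 + a) * h ((1 + k) * t + 1) = (1 - a) * h ((1 - k) * t - 1)"
proof -
  define \<rho> where "\<rho> = (1 + k) / (1 - k)"
  define c where "c = (1 - a) / (1 + a)"
  define q where "q = log \<rho> \<bar>c\<bar>"
  define \<theta> where "\<theta> = (if c > 0 then 0 else pi / ln \<rho>)"
  \<comment> \<open>\<open>z0\<close> is the shifted position of \<open>y = -1\<close>. Dividing by
    it inside the logarithm makes the cosine equal 1 there, so that \<open>h (- 1)\<close> is
    nonzero.\<close>
  define z0 where "z0 = 1 / k - 1"
  define H where "H z = z powr q * cos (\<theta> * ln (z / z0))" for z
  \<comment> \<open>The boundary condition constrains \<open>h\<close> only on \<open>(-1,\<infinity>)\<close>, that is \<open>z > z0\<close>; the phase \<open>\<theta>\<close> makes up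
    for a negative \<open>c\<close>.\<close>
  define h where "h y = H (max (y + 1 / k) z0)" for y
  have \<rho>: "\<rho> > 1" using k by (simp add: \<rho>_def)
  have a': "1 + a \<noteq> 0" using a by auto
  have c: "c \<noteq> 0" using a a' by (simp add: c_def)
  have z0: "z0 > 0" using k by (simp add: z0_def)
  have \<rho>q: "\<rho> powr q = \<bar>c\<bar>" using \<rho> c by (simp add: q_def)
  have H\<rho>: "H (\<rho> * z) = c * H z" if z: "z > 0" for z
  proof -
    have "ln (\<rho> * z / z0) = ln (z / z0) + ln \<rho>"
      using \<rho> z z0 by (simp add: ln_mult ln_div)
    then have "\<theta> * ln (\<rho> * z / z0) = \<theta> * ln (z / z0) + (if c > 0 then 0 else pi)"
      using \<rho> by (simp add: \<theta>_def distrib_left)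
    then have "\<bar>c\<bar> * cos (\<theta> * ln (\<rho> * z / z0)) = c * cos (\<theta> * ln (z / z0))"
      using c by (auto simp: \<theta>_def)
    then show ?thesis using \<rho> z \<rho>q by (simp add: H_def powr_mult)
  qed
  show ?thesis
  proof
    show "continuous_on UNIV h"
      unfolding h_def H_def using z0 by (intro continuous_intros) (auto simp: max_def)
    show "h (- 1) \<noteq> 0" using z0 k by (simp add: h_def H_def z0_def)
    fix t :: real assume t: "t > 0"
    define z where "z = (1 - k) * (t + 1 / k)"
    have "z0 = (1 - k) * (1 / k)" using k by (simp add: z0_def field_simps)
    moreover have "(1 - k) * (1 / k) < z" unfolding z_def using k t by (intro mult_strict_left_mono) auto
    ultimately have z: "z0 < z" by simp
    have "(1 + k) * t + 1 + 1 / k = (1 + k) * (t + 1 / k)"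
      using k by (simp add: field_simps)
    also have "\<dots> = \<rho> * z" using k by (simp add: \<rho>_def z_def)
    finally have "(1 + k) * t + 1 + 1 / k = \<rho> * z" .
    moreover have "(1 - k) * t - 1 + 1 / k = z" using k by (simp add: z_def field_simps)
    \<comment> \<open>Both arguments lie to the right of \<open>z0\<close>, so the truncation is
      inactive.\<close>
    moreover have "max (\<rho> * z) z0 = \<rho> * z" "max z z0 = z"
      using less_trans[OF z, of "\<rho> * z"] \<rho> z z0 by (auto intro!: max_absorb1)
    ultimately have "h ((1 + k) * t + 1) = c * h ((1 - k) * t - 1)"
      using z z0 H\<rho> by (simp add: h_def)
    then show "(1 + a) * h ((1 + k) * t + 1) = (1 - a) * h ((1 - k) * t - 1)"
      using a' by (simp add: c_def)
  qed
qed

lemma ex_positive_energy_solution: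
  assumes k: "0 < k" "k < 1" and a: "a \<noteq> 1" "a \<noteq> -1"
  shows "\<exists>u0 u1 u ux ut. weak_solution k a u0 u1 u ux ut \<and> energy k ux ut 0 > 0"
proof -
  obtain h where h: "continuous_on UNIV h" "h (- 1) \<noteq> 0"
    "\<And>t. t > 0 \<Longrightarrow> (1 + a) * h ((1 + k) * t + 1) = (1 - a) * h ((1 - k) * t - 1)"
    using ex_self_similar_profile[OF k a] by blast
  define ux ut where "ux = (\<lambda>(x, t). h (t + x) - h (t - x))" and "ut = (\<lambda>(x, t). h (t + x) + h (t - x))"
  let ?e = "\<lambda>x. (ut (x, 0))\<^sup>2 + (ux (x, 0))\<^sup>2"
  have cont: "continuous_on {0..1} ?e"
    unfolding ux_def ut_def by (auto intro!: continuous_intros continuous_on_compose2[OF h(1)])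
  have "energy k ux ut 0 = 1 / 2 * integral {0..1} ?e"
    using set_lebesgue_integral_eq_integral(2)[OF absolutely_integrable_continuous_real[OF cont]]
    by (simp add: energy_def len_def)
  moreover have "integral {0..1} ?e \<noteq> 0"
  proof
    assume "integral {0..1} ?e = 0"
    \<comment> \<open>At \<open>x = 1\<close> the integrand is
      \<open>2 * (h 1)^2 + 2 * (h (- 1))^2\<close>, which \<open>h (- 1) \<noteq> 0\<close> keeps
      positive.\<close>
    then have "?e 1 = 0" using integral_eq_0_iff[OF cont] by auto
    then show False using h(2) by (simp add: ux_def ut_def sum_power2_eq_zero_iff)
  qed
  moreover have "0 \<le> integral {0..1} ?e"
    by (rule Henstock_Kurzweil_Integration.integral_nonneg) (auto intro!: integrable_continuous_real cont)
  ultimately have "energy k ux ut 0 > 0" by simp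
  then show ?thesis using ex_weak_solution[OF h(1,3)] unfolding ux_def ut_def by blast
qed

text \<open>The coefficient is a positive multiple of \<open>\<rho> powr (j + 1) - r\<close>, which
  increases with \<open>j\<close> and vanishes at \<open>j = log \<rho> r - 1\<close>. A positive
  value at 0 therefore puts the zero to the left of 0, a negative value to the right. Here
  \<open>a \<noteq> 1\<close> gives \<open>r\<close> its meaning and \<open>a \<noteq> -1\<close>
  makes it positive.\<close>

lemma ex_conserved_weight:
  assumes k: "0 < k" "k < 1" and a: "a \<noteq> 1" "a \<noteq> -1"
  obtains j where "growth_coeff j k a = 0"
    "0 < growth_coeff 0 k a \<Longrightarrow> j < 0" "growth_coeff 0 k a < 0 \<Longrightarrow> 0 < j"
proof -
  define \<rho> where "\<rho> = (1 + k) / (1 - k)"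
  define r where "r = ((1 + a) / (1 - a))\<^sup>2"
  define j where "j = log \<rho> r - 1"
  have \<rho>: "\<rho> > 1" using k by (simp add: \<rho>_def)
  have "1 + a \<noteq> 0" "1 - a \<noteq> 0" using a by auto
  then have r: "r > 0" "r * (1 - a)\<^sup>2 = (1 + a)\<^sup>2" and a2: "0 < (1 - a)\<^sup>2" by (auto simp: r_def power_divide)
  have g: "growth_coeff i k a = (1 - k) powr (i + 1) * (1 - a)\<^sup>2 * (\<rho> powr (i + 1) - r)" for i
  proof -
    have "(1 + k) powr (i + 1) = (1 - k) powr (i + 1) * \<rho> powr (i + 1)"
      using k by (simp add: \<rho>_def powr_divide)
    then show ?thesis by (simp add: growth_coeff_def algebra_simps flip: r(2))
  qed
  have \<rho>j: "\<rho> powr (j + 1) = r" using \<rho> r by (simp add: j_def)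
  have g0: "growth_coeff 0 k a = (1 - k) * (1 - a)\<^sup>2 * (\<rho> - r)" using g[of 0] k \<rho> by simp
  have ka: "0 < (1 - k) * (1 - a)\<^sup>2" using k a2 by simp
  show ?thesis
  proof
    show "growth_coeff j k a = 0" using \<rho>j by (simp add: g)
    assume "0 < growth_coeff 0 k a"
    then have "0 < \<rho> - r" unfolding g0 by (rule zero_less_mult_pos[OF _ ka])
    then have "r < \<rho>" by simp
    then show "j < 0" using log_less_one_cancel_iff[OF \<rho> r(1)] by (simp add: j_def)
  next
    assume "growth_coeff 0 k a < 0"
    then have "\<rho> < r"
      using ka unfolding g0 mult_less_0_iff[of "(1 - k) * (1 - a)\<^sup>2"] by linarith
    then show "0 < j" using one_less_log_cancel_iff[OF \<rho> r(1)] by (simp add: j_def)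
  qed
qed

text \<open>At the exponent with vanishing coefficient both halves of \<open>energy_rate\<close>
  apply, so the energy is of exact size \<open>(1 + k * t) powr (- j)\<close>, and the sign of
  \<open>j\<close> decides between growth and decay.\<close>

lemma ex_polynomial_rate_solution:
  assumes k: "0 < k" "k < 1" and a: "a \<noteq> 1" "a \<noteq> -1"
  shows "\<exists>u0 u1 u ux ut. weak_solution k a u0 u1 u ux ut \<and> energy k ux ut 0 > 0 \<and>
    (0 < growth_coeff 0 k a \<longrightarrow> increases_only_polynomially (energy k ux ut)) \<and>
    (growth_coeff 0 k a < 0 \<longrightarrow> decreases_only_polynomially (energy k ux ut))"
proof -
  obtain j where j: "growth_coeff j k a = 0"
    "0 < growth_coeff 0 k a \<Longrightarrow> j < 0" "growth_coeff 0 k a < 0 \<Longrightarrow> 0 < j"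
    using ex_conserved_weight[OF k a] by blast
  obtain c C where cC: "0 < c" "0 < C"
    "\<And>a u0 u1 u ux ut t. weak_solution k a u0 u1 u ux ut \<Longrightarrow> 0 \<le> t \<Longrightarrow> 0 \<le> growth_coeff j k a \<Longrightarrow>
      c * (1 + k * t) powr (- j) * energy k ux ut 0 \<le> energy k ux ut t"
    "\<And>a u0 u1 u ux ut t. weak_solution k a u0 u1 u ux ut \<Longrightarrow> 0 \<le> t \<Longrightarrow> growth_coeff j k a \<le> 0 \<Longrightarrow>
      energy k ux ut t \<le> C * (1 + k * t) powr (- j) * energy k ux ut 0"
    using energy_rate[OF k, where j=j] by metis
  obtain m M where mM: "0 < m" "0 < M" "\<And>x. k \<le> x \<Longrightarrow> x \<le> 1 \<Longrightarrow> m \<le> x powr (- j) \<and> x powr (- j) \<le> M"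
    using powr_bounds[of k 1 "- j"] k by auto
  obtain u0 u1 u ux ut where sol: "weak_solution k a u0 u1 u ux ut" and E0: "energy k ux ut 0 > 0"
    using ex_positive_energy_solution[OF k a] by blast
  let ?E = "energy k ux ut"
  have rate: "c * m * (1 + t) powr (- j) * ?E 0 \<le> ?E t \<and> ?E t \<le> C * M * (1 + t) powr (- j) * ?E 0"
    if t: "t > 0" for t
  proof -
    \<comment> \<open>This quotient stays in \<open>[k, 1]\<close>, so passing from powers of
      \<open>1 + k * t\<close> to powers of \<open>1 + t\<close> costs only the constants
      \<open>m\<close> and \<open>M\<close>.\<close>
    define x where "x = (1 + k * t) / (1 + t)"
    have "k * (1 + t) \<le> 1 + k * t" "1 + k * t \<le> 1 + t" using k t by (simp_all add: algebra_simps)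
    then have x: "k \<le> x" "x \<le> 1" using t by (simp_all add: x_def field_simps)
    have "1 + k * t = x * (1 + t)" using t by (simp add: x_def)
    then have p: "(1 + k * t) powr (- j) = x powr (- j) * (1 + t) powr (- j)"
      using x k t by (simp add: powr_mult)
    have "c * m * (1 + t) powr (- j) * ?E 0 \<le> c * (1 + k * t) powr (- j) * ?E 0"
      using mM(3)[OF x] cC(1) E0 unfolding p
      by (simp add: mult.assoc mult_left_mono mult_right_mono)
    moreover have "C * (1 + k * t) powr (- j) * ?E 0 \<le> C * M * (1 + t) powr (- j) * ?E 0"
      using mM(3)[OF x] cC(2) E0 unfolding p
      by (simp add: mult.assoc mult_left_mono mult_right_mono)
    ultimately show ?thesis
      using cC(3)[OF sol less_imp_le[OF t] eq_refl[OF j(1)[symmetric]]]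
        cC(4)[OF sol less_imp_le[OF t] eq_refl[OF j(1)]]
      by linarith
  qed
  have pos: "0 < c * m" "0 < C * M" using cC mM by simp_all
  have "increases_only_polynomially ?E" if "0 < growth_coeff 0 k a"
  proof -
    have "0 < - j" using j(2)[OF that] by simp
    then show ?thesis unfolding increases_only_polynomially_def using pos rate by blast
  qed
  moreover have "decreases_only_polynomially ?E" if "growth_coeff 0 k a < 0"
  proof -
    have "- j < 0" using j(3)[OF that] by simp
    then show ?thesis unfolding decreases_only_polynomially_def using pos rate by blast
  qed
  ultimately show ?thesis using sol E0 by blast
qed

section \<open>Reading the cases off the zeros of the growth coefficients\<close>

theorem theorem1p2:
  fixes k a a1 a2 b1 b2 :: real
  assumes "0 < k" and "k < 1"
    and "a1 = (1 - sqrt (1 - k\<^sup>2)) / k" and "a2 = (1 + sqrt (1 - k\<^sup>2)) / k"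
    and "b1 = k" and "b2 = 1 / k"
  shows "(a1 < b1 \<and> b1 < b2 \<and> b2 < a2) \<and>
    (a < a1 \<or> a > a2 \<longrightarrow>
       energy_increasing k a \<and>
       (\<exists>u0 u1 u ux ut. weak_solution k a u0 u1 u ux ut \<and>
          (a \<noteq> -1 \<longrightarrow> energy k ux ut 0 > 0) \<and>
          increases_only_polynomially (energy k ux ut))) \<and>
    (a = a1 \<or> a = a2 \<longrightarrow> energy_conserved k a) \<and>
    (a1 < a \<and> a < a2 \<longrightarrow>
       energy_decreasing k a \<and>
       (\<exists>u0 u1 u ux ut. weak_solution k a u0 u1 u ux ut \<and>
          (a \<noteq> 1 \<longrightarrow> energy k ux ut 0 > 0) \<and>
          decreases_only_polynomially (energy k ux ut))) \<and>
    (a = b1 \<or> a = b2 \<longrightarrow> decays_only_at_order 1 k a) \<and>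
    (b1 < a \<and> a < b2 \<longrightarrow> decays_no_less_than_order 1 k a) \<and>
    ((a1 < a \<and> a < b1) \<or> (b2 < a \<and> a < a2) \<longrightarrow> decays_no_more_than_order 1 k a)"
proof -
  note k = assms(1,2)
  define s where "s = sqrt (1 - k\<^sup>2)"
  have k2: "0 < k\<^sup>2" "k\<^sup>2 < 1" using k by (simp_all add: power_less_one_iff)
  have s2: "s * s = 1 - k * k" using k2 by (simp add: s_def flip: power2_eq_square)
  have s: "0 < s" "s < 1" using k2 by (simp_all add: s_def)
  have a12: "a1 = (1 - s) / k" "a2 = (1 + s) / k" using assms(3,4) by (simp_all add: s_def)
  \<comment> \<open>After multiplication by \<open>k\<close>, the claim \<open>a1 < b1\<close> is
    \<open>1 - s < k^2\<close>, and \<open>k^2\<close> factors as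
    \<open>(1 - s) * (1 + s)\<close>.\<close>
  have "(1 - s) * 1 < (1 - s) * (1 + s)" using s by (intro mult_strict_left_mono) auto
  then have "1 - s < k * k" using s2 by (simp add: algebra_simps)
  then have a1b1: "a1 < b1" using k by (simp add: a12 assms(5) field_simps)
  have "k * k < 1" using k2 by (simp add: power2_eq_square)
  then have b1b2: "b1 < b2" using k by (simp add: assms(5,6) field_simps)
  have b2a2: "b2 < a2" using k s by (simp add: a12 assms(6) divide_strict_right_mono)
  \<comment> \<open>For \<open>j = 0\<close> the coefficient is
    \<open>2 * (k * a^2 - 2 * a + k)\<close>, whose roots are \<open>a1\<close> and
    \<open>a2\<close>. The extra factor \<open>k\<close> clears their denominators.\<close>
  have "k * a1 = 1 - s" "k * a2 = 1 + s" using k by (simp_all add: a12)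
  then have "k * growth_coeff 0 k a = k * (2 * k * (a - a1) * (a - a2))"
    using k s2 unfolding growth_coeff_def by (simp, algebra)
  then have g0: "growth_coeff 0 k a = 2 * k * (a - a1) * (a - a2)" using k by simp
  have inc: "growth_coeff 0 k a > 0" if "a < a1 \<or> a > a2"
  proof -
    have "0 < (a - a1) * (a - a2)"
      using that a1b1 b1b2 b2a2 by (auto intro: mult_neg_neg mult_pos_pos)
    then show ?thesis using k by (simp add: g0 mult.assoc)
  qed
  have dec: "growth_coeff 0 k a < 0" if "a1 < a \<and> a < a2"
  proof -
    have "(a - a1) * (a - a2) < 0"
      using that by (auto intro: mult_pos_neg)
    then show ?thesis using k by (simp add: g0 mult.assoc mult_pos_neg)
  qed
  have g1: "growth_coeff 1 k a = 4 * k * (a - b1) * (a - b2)"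
    using k unfolding growth_coeff_1[OF k] assms(5,6) by (simp add: field_simps)
  have incr: "energy_increasing k a \<and> (\<exists>u0 u1 u ux ut. weak_solution k a u0 u1 u ux ut \<and>
      (a \<noteq> -1 \<longrightarrow> energy k ux ut 0 > 0) \<and> increases_only_polynomially (energy k ux ut))"
    if "a < a1 \<or> a > a2"
  proof (cases "a = -1")
    case True
    obtain u0 u1 u ux ut where "weak_solution k a u0 u1 u ux ut" "\<And>t. energy k ux ut t = 0"
      using ex_zero_solution by blast
    moreover then have "increases_only_polynomially (energy k ux ut)"
      \<comment> \<open>All three quantities are 0, so any positive exponent and constants
        do.\<close>
      by (auto simp: increases_only_polynomially_def intro: exI[of _ "1::real"])
    ultimately show ?thesis using energy_mono(1)[OF k] less_imp_le[OF inc[OF that]] True by blast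
  next
    case False
    \<comment> \<open>At \<open>a = 1\<close> the coefficient would be
      \<open>-4 * (1 - k) < 0\<close>.\<close>
    have "a \<noteq> 1" using inc[OF that] k by (auto simp: growth_coeff_def)
    then show ?thesis
      using ex_polynomial_rate_solution[OF k _ False] energy_mono(1)[OF k less_imp_le] inc[OF that] by blast
  qed
  have decr: "energy_decreasing k a \<and> (\<exists>u0 u1 u ux ut. weak_solution k a u0 u1 u ux ut \<and>
      (a \<noteq> 1 \<longrightarrow> energy k ux ut 0 > 0) \<and> decreases_only_polynomially (energy k ux ut))"
    if "a1 < a \<and> a < a2"
  proof (cases "a = 1")
    case True
    obtain u0 u1 u ux ut where "weak_solution k a u0 u1 u ux ut" "\<And>t. energy k ux ut t = 0"
      using ex_zero_solution by blast
    moreover then have "decreases_only_polynomially (energy k ux ut)"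
      by (auto simp: decreases_only_polynomially_def intro: exI[of _ "1::real"] exI[of _ "-1::real"])
    ultimately show ?thesis using energy_mono(2)[OF k] less_imp_le[OF dec[OF that]] True by blast
  next
    case False
    \<comment> \<open>At \<open>a = -1\<close> the coefficient would be
      \<open>4 * (1 + k) > 0\<close>.\<close>
    have "a \<noteq> -1" using dec[OF that] k by (auto simp: growth_coeff_def)
    then show ?thesis
      using ex_polynomial_rate_solution[OF k False] energy_mono(2)[OF k less_imp_le] dec[OF that] by blast
  qed
  have cons: "energy_conserved k a" if "a = a1 \<or> a = a2"
  proof -
    have "growth_coeff 0 k a = 0" using that g0 by auto
    then have "energy_increasing k a" "energy_decreasing k a" using energy_mono[OF k] by simp_all
    then show ?thesis unfolding energy_increasing_def energy_decreasing_def energy_conserved_def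
      by (auto intro: order_antisym)
  qed
  have "decays_only_at_order 1 k a" if "a = b1 \<or> a = b2"
    using that by (intro first_order_rates(3)[OF k]) (auto simp: g1)
  moreover have "decays_no_less_than_order 1 k a" if "b1 < a \<and> a < b2"
  proof -
    have "(a - b1) * (a - b2) \<le> 0" using that by (auto intro: mult_nonneg_nonpos)
    then show ?thesis
      using k by (intro first_order_rates(1)[OF k]) (simp add: g1 mult.assoc mult_nonneg_nonpos)
  qed
  moreover have "decays_no_more_than_order 1 k a" if "a < b1 \<or> b2 < a"
  proof -
    have "0 \<le> (a - b1) * (a - b2)"
      using that b1b2 by (auto intro: mult_nonpos_nonpos mult_nonneg_nonneg)
    then show ?thesis using k by (intro first_order_rates(2)[OF k]) (simp add: g1 mult.assoc)
  qed
  ultimately show ?thesis using a1b1 b1b2 b2a2 incr decr cons by blast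
qed

end
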